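(* Let $\mathcal{A}$ be an arbitrary (not necessarily unital) $C^*$-algebra and let $t : Dom(t) \subseteq E \to F$ be an $\mathcal A$-linear densely defined operator between Hilbert $\mathcal A$-modules $E$ and $F$. Then the following two conditions are equivalent: (1) the graph $G(t)$ of $t$ is orthogonally complemented in $E \oplus F$ and $\overline{Ran ( P_F P_{G(t)^{ \perp}})}= Ran ( P_F P_{G(t)^{ \perp}}) ^{ \perp \perp}$ (biorthogonal complement in $F$); (2) $t$ is regular, i.e. $t$ is adjointable, closed, and the range of $1+t^*t$ is dense in $E$.
   Context: Hilbert $\mathcal{A}$-modules are left modules, complete in the norm $\|x\|=\|\langle x,x\rangle\|^{1/2}$, with $\mathcal{A}$-valued inner product $\mathcal{A}$-linear in the first variable; complex-linear structures on $\mathcal{A}$ and the modules are compatible. $E\oplus F$ carries the inner product $\langle (x_1,y_1),(x_2,y_2)\rangle=\langle x_1,x_2\rangle_E+\langle y_1,y_2\rangle_F$. A closed submodule $W$ of a Hilbert $\mathcal{A}$-module $M$ is orthogonally complemented (an orthogonal summand) if $M=W\oplus W^\perp$, where $W^\perp=\{m\in M:\langle m,w\rangle=0 \text{ for all } w\in W\}$ (an arbitrary submodule $W$ with $M = W\oplus W^\perp$ is automatically closed); $P_W$ denotes the orthogonal projection onto such $W$. $P_F: E\oplus F\to F$ is the canonical projection $(x,y)\mapsto y$. For $X\subseteq F$, $X^{\perp\perp}=(X^\perp)^\perp$. A densely defined operator $t:Dom(t)\subseteq E\to F$ is an $\mathcal{A}$-linear map with domain a dense submodule $Dom(t)$ of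 $E$. Its graph is $G(t)=\{(x,tx):x\in Dom(t)\}\subseteq E\oplus F$; $t$ is closed if $G(t)$ is a closed submodule. The adjoint $t^*$ has domain $$Dom(t^* )=\{y\in F:\ \exists\, z\in E \text{ with } \langle tx,y\rangle_F=\langle x,z\rangle_E \text{ for all } x\in Dom(t)\},$$ and $t^*y=z$ (unique since $Dom(t)$ is dense). The operator $t$ is called adjointable if $Dom(t^* )$ is dense in $F$. The operator $1+t^*t$ has domain $\{x\in Dom(t): tx\in Dom(t^* )\}$. *)

theory Defs
  imports "HOL-Analysis.Analysis"
begin

class complex_vector = real_vector +
  fixes scaleC :: "complex \<Rightarrow> 'a \<Rightarrow> 'a"  (infixr "*\<^sub>C" 75)
  assumes scaleC_add_right: "c *\<^sub>C (x + y) = c *\<^sub>C x + c *\<^sub>C y"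
    and scaleC_add_left: "(c + d) *\<^sub>C x = c *\<^sub>C x + d *\<^sub>C x"
    and scaleC_scaleC: "c *\<^sub>C (d *\<^sub>C x) = (c * d) *\<^sub>C x"
    and scaleC_of_real: "complex_of_real r *\<^sub>C x = r *\<^sub>R x"

instantiation prod :: (complex_vector, complex_vector) complex_vector
begin

definition scaleC_prod :: "complex \<Rightarrow> 'a \<times> 'b \<Rightarrow> 'a \<times> 'b"
  where "scaleC_prod c z = (c *\<^sub>C fst z, c *\<^sub>C snd z)"

instance
  by standard
    (auto simp: scaleC_prod_def scaleC_add_right scaleC_add_left scaleC_scaleC
      scaleC_of_real scaleR_prod_def)

end

text \<open>The class \<open>real_normed_algebra\<close> does not provide a unit, so the algebra may be
  non-unital (and may be zero).\<close>

class cstar_algebra = complex_vector + real_normed_algebra + banach +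
  fixes star :: "'a \<Rightarrow> 'a"
  assumes norm_scaleC: "norm (c *\<^sub>C a) = cmod c * norm a"
    and mult_scaleC_left: "(c *\<^sub>C a) * b = c *\<^sub>C (a * b)"
    and mult_scaleC_right: "a * (c *\<^sub>C b) = c *\<^sub>C (a * b)"
    and star_add: "star (a + b) = star a + star b"
    and star_scaleC: "star (c *\<^sub>C a) = cnj c *\<^sub>C star a"
    and star_mult: "star (a * b) = star b * star a"
    and star_star: "star (star a) = a"
    and norm_star_mult_self: "norm (star a * a) = (norm a)\<^sup>2"

definition cstar_positive :: "'a::cstar_algebra \<Rightarrow> bool"
  where "cstar_positive a \<longleftrightarrow> (\<exists>b. a = star b * b)"

text \<open>A Hilbert module occupies a whole type. Its Hilbert-module norm is required to be the
  norm of the type, so that completeness is the sort constraint \<open>banach\<close> and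
  topological notions are those of the type; definiteness of the inner product follows
  from \<open>norm_eq\<close>.\<close>

locale hilbert_module =
  fixes act :: "'a::cstar_algebra \<Rightarrow> 'e::{complex_vector, banach} \<Rightarrow> 'e"
    and ip :: "'e \<Rightarrow> 'e \<Rightarrow> 'a"
  assumes act_add_left: "act (a + b) x = act a x + act b x"
    and act_add_right: "act a (x + y) = act a x + act a y"
    and act_act: "act a (act b x) = act (a * b) x"
    and act_scaleC_left: "act (c *\<^sub>C a) x = c *\<^sub>C act a x"
    and act_scaleC_right: "act a (c *\<^sub>C x) = c *\<^sub>C act a x"
    and ip_add_left: "ip (x + y) z = ip x z + ip y z"
    and ip_scaleC_left: "ip (c *\<^sub>C x) y = c *\<^sub>C ip x y"
    and ip_act_left: "ip (act a x) y = a * ip x y"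
    and ip_star: "star (ip x y) = ip y x"
    and ip_positive: "cstar_positive (ip x x)"
    and norm_eq: "norm x = sqrt (norm (ip x x))"

definition submodule :: "('a \<Rightarrow> 'e \<Rightarrow> 'e) \<Rightarrow> 'e::complex_vector set \<Rightarrow> bool"
  where "submodule act W \<longleftrightarrow>
    0 \<in> W \<and> (\<forall>x\<in>W. \<forall>y\<in>W. x + y \<in> W) \<and>
    (\<forall>c. \<forall>x\<in>W. c *\<^sub>C x \<in> W) \<and> (\<forall>a. \<forall>x\<in>W. act a x \<in> W)"

definition act_sum :: "('a \<Rightarrow> 'e \<Rightarrow> 'e) \<Rightarrow> ('a \<Rightarrow> 'f \<Rightarrow> 'f) \<Rightarrow> 'a \<Rightarrow> 'e \<times> 'f \<Rightarrow> 'e \<times> 'f"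
  where "act_sum actE actF a z = (actE a (fst z), actF a (snd z))"

definition ip_sum :: "('e \<Rightarrow> 'e \<Rightarrow> 'a::plus) \<Rightarrow> ('f \<Rightarrow> 'f \<Rightarrow> 'a) \<Rightarrow> 'e \<times> 'f \<Rightarrow> 'e \<times> 'f \<Rightarrow> 'a"
  where "ip_sum ipE ipF z w = ipE (fst z) (fst w) + ipF (snd z) (snd w)"

definition orth_compl :: "('m \<Rightarrow> 'm \<Rightarrow> 'a::zero) \<Rightarrow> 'm set \<Rightarrow> 'm set"
  where "orth_compl ip W = {m. \<forall>w\<in>W. ip m w = 0}"

text \<open>Closedness of \<open>W\<close> is not demanded: it is a consequence of the decomposition.\<close>

definition orth_complemented ::
    "('a \<Rightarrow> 'm \<Rightarrow> 'm) \<Rightarrow> ('m \<Rightarrow> 'm \<Rightarrow> 'a::zero) \<Rightarrow> 'm::complex_vector set \<Rightarrow> bool"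
  where "orth_complemented act ip W \<longleftrightarrow>
    submodule act W \<and> W \<inter> orth_compl ip W = {0} \<and>
    (\<forall>m. \<exists>w\<in>W. \<exists>v\<in>orth_compl ip W. m = w + v)"

text \<open>Meaningful only if \<open>W\<close> is orthogonally complemented.\<close>

definition orth_proj :: "('m \<Rightarrow> 'm \<Rightarrow> 'a::zero) \<Rightarrow> 'm set \<Rightarrow> 'm \<Rightarrow> 'm::complex_vector"
  where "orth_proj ip W m = (THE w. w \<in> W \<and> m - w \<in> orth_compl ip W)"

text \<open>An unbounded operator is a pair of a domain \<open>D\<close> and a total function \<open>t\<close> whose
  values outside \<open>D\<close> are irrelevant.\<close>

definition densely_defined_operator ::
    "('a \<Rightarrow> 'e \<Rightarrow> 'e) \<Rightarrow> ('a \<Rightarrow> 'f \<Rightarrow> 'f) \<Rightarrow>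
     'e::{complex_vector, topological_space} set \<Rightarrow> ('e \<Rightarrow> 'f::complex_vector) \<Rightarrow> bool"
  where "densely_defined_operator actE actF D t \<longleftrightarrow>
    submodule actE D \<and> closure D = UNIV \<and>
    (\<forall>x\<in>D. \<forall>y\<in>D. t (x + y) = t x + t y) \<and>
    (\<forall>c. \<forall>x\<in>D. t (c *\<^sub>C x) = c *\<^sub>C t x) \<and>
    (\<forall>a. \<forall>x\<in>D. t (actE a x) = actF a (t x))"

definition op_graph :: "'e set \<Rightarrow> ('e \<Rightarrow> 'f) \<Rightarrow> ('e \<times> 'f) set"
  where "op_graph D t = (\<lambda>x. (x, t x)) ` D"

definition adj_dom ::
    "('e \<Rightarrow> 'e \<Rightarrow> 'a) \<Rightarrow> ('f \<Rightarrow> 'f \<Rightarrow> 'a) \<Rightarrow> 'e set \<Rightarrow> ('e \<Rightarrow> 'f) \<Rightarrow> 'f set"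
  where "adj_dom ipE ipF D t = {y. \<exists>z. \<forall>x\<in>D. ipF (t x) y = ipE x z}"

definition adj_op ::
    "('e \<Rightarrow> 'e \<Rightarrow> 'a) \<Rightarrow> ('f \<Rightarrow> 'f \<Rightarrow> 'a) \<Rightarrow> 'e set \<Rightarrow> ('e \<Rightarrow> 'f) \<Rightarrow> 'f \<Rightarrow> 'e"
  where "adj_op ipE ipF D t y = (THE z. \<forall>x\<in>D. ipF (t x) y = ipE x z)"

definition adjointable ::
    "('e \<Rightarrow> 'e \<Rightarrow> 'a) \<Rightarrow> ('f \<Rightarrow> 'f \<Rightarrow> 'a) \<Rightarrow> 'e set \<Rightarrow> ('e \<Rightarrow> 'f::topological_space) \<Rightarrow> bool"
  where "adjointable ipE ipF D t \<longleftrightarrow> closure (adj_dom ipE ipF D t) = UNIV"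

text \<open>The product topology on \<open>E \<oplus> F\<close> is the topology of its Hilbert-module norm: the
  latter lies between the maximum of the two norms and the Euclidean product norm.\<close>

definition closed_operator ::
    "'e::topological_space set \<Rightarrow> ('e \<Rightarrow> 'f::topological_space) \<Rightarrow> bool"
  where "closed_operator D t \<longleftrightarrow> closed (op_graph D t)"

definition range_one_plus_adj ::
    "('e \<Rightarrow> 'e \<Rightarrow> 'a) \<Rightarrow> ('f \<Rightarrow> 'f \<Rightarrow> 'a) \<Rightarrow> 'e set \<Rightarrow> ('e \<Rightarrow> 'f) \<Rightarrow> 'e::plus set"
  where "range_one_plus_adj ipE ipF D t =
    {x + adj_op ipE ipF D t (t x) | x. x \<in> D \<and> t x \<in> adj_dom ipE ipF D t}"

definition regular_operator ::
    "('e \<Rightarrow> 'e \<Rightarrow> 'a) \<Rightarrow> ('f \<Rightarrow> 'f \<Rightarrow> 'a) \<Rightarrow>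
     'e::{plus, topological_space} set \<Rightarrow> ('e \<Rightarrow> 'f::topological_space) \<Rightarrow> bool"
  where "regular_operator ipE ipF D t \<longleftrightarrow>
    adjointable ipE ipF D t \<and> closed_operator D t \<and>
    closure (range_one_plus_adj ipE ipF D t) = UNIV"

end

theory Submission
  imports Defs
begin

text \<open>Write \<open>G\<close> for the graph of \<open>t\<close>. The proof rests on the observation that
  \<open>G\<^sup>\<bottom> = {(- t\<^sup>* y, y) | y. y \<in> Dom(t\<^sup>*)}\<close>. Two things follow from it. The range of
  \<open>P\<^sub>F P\<close>, with \<open>P\<close> the projection onto \<open>G\<^sup>\<bottom>\<close>, is \<open>Dom(t\<^sup>*)\<close>. And a decomposition
  \<open>(x, 0) = (u, t u) + (- t\<^sup>* y, y)\<close> forces \<open>y = - t u\<close>, so that \<open>(x, 0)\<close> belongs to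
  \<open>G + G\<^sup>\<bottom>\<close> exactly if \<open>x\<close> lies in the range of \<open>1 + t\<^sup>* t\<close>.

  Suppose that \<open>G + G\<^sup>\<bottom>\<close> is everything. Then \<open>G = G\<^sup>\<bottom>\<^sup>\<bottom>\<close> is closed and \<open>1 + t\<^sup>* t\<close> is
  surjective. If \<open>y \<bottom> Dom(t\<^sup>*)\<close>, then \<open>(0, y) \<bottom> G\<^sup>\<bottom>\<close>, so \<open>(0, y) \<in> G\<close> and \<open>y = t 0 = 0\<close>.
  The biorthogonal complement of \<open>Dom(t\<^sup>*)\<close> is therefore all of \<open>F\<close>, and the condition on
  closures turns this into density of \<open>Dom(t\<^sup>*)\<close>.

  Suppose conversely that \<open>t\<close> is regular. The sum of a closed submodule and its orthogonal
  complement is closed (\<open>closed_orth_sum\<close>). Hence the set of all \<open>x\<close> with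
  \<open>(x, 0) \<in> G + G\<^sup>\<bottom>\<close> is closed; it is the dense range of \<open>1 + t\<^sup>* t\<close>, and so equals \<open>E\<close>.
  For \<open>y \<in> Dom(t\<^sup>*)\<close> the vector \<open>(0, y) = (- t\<^sup>* y, y) + (t\<^sup>* y, 0)\<close> is then in
  \<open>G + G\<^sup>\<bottom>\<close> as well, and density of \<open>Dom(t\<^sup>*)\<close> gives it for all \<open>y \<in> F\<close>.

  Closedness of such a sum needs \<open>\<parallel>\<langle>w, w\<rangle>\<parallel> \<le> \<parallel>\<langle>w, w\<rangle> + \<langle>v, v\<rangle>\<parallel>\<close>. In terms of the algebra this
  is \<open>\<parallel>b\<^sup>* b\<parallel> \<le> \<parallel>b\<^sup>* b + c\<^sup>* c\<parallel>\<close>, a form of the theorem of Fukamiya and Kaplansky that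
  elements \<open>b\<^sup>* b\<close> are positive. Most of the text proves this inequality, in the unitization and
  without spectra or functional calculus: positivity of a selfadjoint \<open>h\<close> is expressed by
  \<open>\<parallel>\<beta> - h\<parallel> \<le> \<beta>\<close> for some real \<open>\<beta> \<ge> 0\<close>, and square roots are limits of an explicit iteration.\<close>

section \<open>Elementary properties of complex scalars and of the involution\<close>

lemma scaleC_zero_left [simp]: "0 *\<^sub>C x = 0"
  using scaleC_of_real[of 0 x] by simp

lemma scaleC_one [simp]: "1 *\<^sub>C x = x"
  using scaleC_of_real[of 1 x] by simp

lemma scaleC_minus_one: "(- 1) *\<^sub>C x = - x"
  using scaleC_of_real[of "- 1" x] by simp

lemma scaleC_zero_right [simp]: "c *\<^sub>C 0 = 0"
  using scaleC_add_right[of c 0 0] by simp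

lemma scaleC_minus_left: "(- c) *\<^sub>C x = - (c *\<^sub>C x)"
  using scaleC_add_left[of "- c" c x] by (simp add: eq_neg_iff_add_eq_0)

lemma scaleC_minus_right: "c *\<^sub>C (- x) = - (c *\<^sub>C x)"
  using scaleC_add_right[of c "- x" x] by (simp add: eq_neg_iff_add_eq_0)

lemma scaleC_diff_right: "c *\<^sub>C (x - y) = c *\<^sub>C x - c *\<^sub>C y"
  using scaleC_add_right[of c x "- y"] by (simp add: scaleC_minus_right)

lemma scaleC_scaleR: "c *\<^sub>C (r *\<^sub>R x) = r *\<^sub>R (c *\<^sub>C x)"
  by (metis mult.commute scaleC_of_real scaleC_scaleC)

lemma scaleR_scaleC: "(r *\<^sub>R c) *\<^sub>C x = r *\<^sub>R (c *\<^sub>C x)"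
  by (metis scaleC_of_real scaleC_scaleC scaleR_conv_of_real)

lemma scaleC_imaginary_imaginary: "\<i> *\<^sub>C (\<i> *\<^sub>C x) = - x"
  by (simp add: scaleC_scaleC scaleC_minus_one)

lemma norm_star [simp]: "norm (star a) = norm (a :: 'a::cstar_algebra)"
proof -
  have le: "norm b \<le> norm (star b)" for b :: 'a
  proof (cases "b = 0")
    case False
    have "norm b * norm b \<le> norm (star b) * norm b"
      using norm_mult_ineq[of "star b" b] norm_star_mult_self[of b] by (simp add: power2_eq_square)
    with False show ?thesis by simp
  qed simp
  show ?thesis using le[of a] le[of "star a"] by (simp add: star_star)
qed

lemma star_scaleR [simp]: "star (r *\<^sub>R a) = r *\<^sub>R star (a :: 'a::cstar_algebra)"
  by (metis complex_cnj_complex_of_real scaleC_of_real star_scaleC)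

lemma bounded_linear_star: "bounded_linear (star :: 'a::cstar_algebra \<Rightarrow> 'a)"
  by (rule bounded_linear_intro[where K = 1]) (auto simp: star_add)

lemma star_zero [simp]: "star (0 :: 'a::cstar_algebra) = 0"
  using star_scaleR[of 0 0] by simp

lemma star_minus [simp]: "star (- a) = - star (a :: 'a::cstar_algebra)"
  using star_scaleR[of "- 1" a] by simp

lemma star_diff: "star (a - b) = star a - star (b :: 'a::cstar_algebra)"
  using star_add[of a "- b"] by simp

lemma bounded_linear_scaleC:
  "bounded_linear (\<lambda>a. c *\<^sub>C (a :: 'a::cstar_algebra))"
  by (rule bounded_linear_intro[where K = "cmod c"])
    (auto simp: scaleC_add_right scaleC_scaleR norm_scaleC)

section \<open>The unitization of a C*-algebra\<close>

text \<open>The pair of \<open>a\<close> and \<open>\<lambda>\<close> stands for \<open>a + \<lambda> 1\<close>. It acts on the algebra by left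
  multiplication, and the operator norm of this action is a C*-seminorm. If the algebra already
  has a unit \<open>e\<close>, the seminorm vanishes at \<open>1 - e\<close>; taking the maximum with \<open>\<bar>\<lambda>\<bar>\<close>, the seminorm
  of a character, repairs this and treats the unital and the non-unital case alike.\<close>

datatype 'a unitization = Unitization (algebra_part: 'a) (scalar_part: complex)

definition left_mult :: "'a::cstar_algebra unitization \<Rightarrow> 'a \<Rightarrow> 'a"
  where "left_mult z x = algebra_part z * x + scalar_part z *\<^sub>C x"

instantiation unitization :: (cstar_algebra) ring_1
begin

definition "0 = Unitization 0 0"
definition "1 = Unitization 0 1"
definition "z + w = Unitization (algebra_part z + algebra_part w) (scalar_part z + scalar_part w)"
definition "z - w = Unitization (algebra_part z - algebra_part w) (scalar_part z - scalar_part w)"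
definition "- z = Unitization (- algebra_part z) (- scalar_part z)"
definition "z * w = Unitization
  (algebra_part z * algebra_part w + scalar_part z *\<^sub>C algebra_part w + scalar_part w *\<^sub>C algebra_part z)
  (scalar_part z * scalar_part w)"

instance
  by standard
    (auto simp: zero_unitization_def one_unitization_def plus_unitization_def
      minus_unitization_def uminus_unitization_def times_unitization_def algebra_simps
      scaleC_add_left scaleC_add_right scaleC_scaleC mult_scaleC_left mult_scaleC_right)

end

lemma unitization_parts [simp]:
  "algebra_part (0 :: 'a::cstar_algebra unitization) = 0"
  "scalar_part (0 :: 'a unitization) = 0"
  "algebra_part (1 :: 'a unitization) = 0" "scalar_part (1 :: 'a unitization) = 1"
  "algebra_part (z + w) = algebra_part z + algebra_part (w :: 'a unitization)"
  "scalar_part (z + w) = scalar_part z + scalar_part w"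
  "algebra_part (z - w) = algebra_part z - algebra_part w"
  "scalar_part (z - w) = scalar_part z - scalar_part w"
  "algebra_part (- z) = - algebra_part z" "scalar_part (- z) = - scalar_part z"
  "algebra_part (z * w) = algebra_part z * algebra_part w
     + scalar_part z *\<^sub>C algebra_part w + scalar_part w *\<^sub>C algebra_part z"
  "scalar_part (z * w) = scalar_part z * scalar_part w"
  by (simp_all add: zero_unitization_def one_unitization_def plus_unitization_def
      minus_unitization_def uminus_unitization_def times_unitization_def)

instantiation unitization :: (cstar_algebra) complex_vector
begin

definition "r *\<^sub>R z = Unitization (r *\<^sub>R algebra_part z) (r *\<^sub>R scalar_part z)"
definition "c *\<^sub>C z = Unitization (c *\<^sub>C algebra_part z) (c * scalar_part z)"

instance
  by standard
    (auto intro!: unitization.expand simp: scaleR_unitization_def scaleC_unitization_def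
      scaleC_add_left scaleC_add_right scaleC_scaleC scaleC_of_real scaleR_conv_of_real
      algebra_simps)

end

lemma unitization_scale_parts [simp]:
  "algebra_part (r *\<^sub>R z) = r *\<^sub>R algebra_part (z :: 'a::cstar_algebra unitization)"
  "scalar_part (r *\<^sub>R z) = r *\<^sub>R scalar_part z"
  "algebra_part (c *\<^sub>C z) = c *\<^sub>C algebra_part z"
  "scalar_part (c *\<^sub>C z) = c * scalar_part z"
  by (simp_all add: scaleR_unitization_def scaleC_unitization_def)

lemma bounded_linear_left_mult: "bounded_linear (left_mult z)"
  unfolding left_mult_def
  by (intro bounded_linear_add bounded_linear_mult_right bounded_linear_scaleC)

lemma norm_left_mult_le: "norm (left_mult z x) \<le> onorm (left_mult z) * norm x"
  by (rule onorm[OF bounded_linear_left_mult])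

lemma left_mult_add: "left_mult (z + w) = (\<lambda>x. left_mult z x + left_mult w x)"
  by (auto simp: left_mult_def fun_eq_iff scaleC_add_left algebra_simps)

lemma left_mult_mult: "left_mult (z * w) = left_mult z \<circ> left_mult w"
  by (auto simp: left_mult_def fun_eq_iff scaleC_add_right scaleC_scaleC mult_scaleC_left
      mult_scaleC_right algebra_simps)

lemma left_mult_scaleC: "left_mult (c *\<^sub>C z) = (\<lambda>x. c *\<^sub>C left_mult z x)"
  by (auto simp: left_mult_def fun_eq_iff scaleC_add_right scaleC_scaleC mult_scaleC_left)

lemma left_mult_scaleR: "left_mult (r *\<^sub>R z) = (\<lambda>x. r *\<^sub>R left_mult z x)"
  using left_mult_scaleC[of "complex_of_real r" z] by (simp add: scaleC_of_real)

text \<open>The C*-identity makes \<open>star a\<close> a vector at which the norm of left multiplication by \<open>a\<close> is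
  attained, so the algebra embeds isometrically in its unitization.\<close>

lemma onorm_left_mult_algebra:
  "onorm (left_mult (Unitization a 0)) = norm (a :: 'a::cstar_algebra)"
proof (rule antisym)
  show "onorm (left_mult (Unitization a 0)) \<le> norm a"
    by (rule onorm_bound) (auto simp: left_mult_def norm_mult_ineq)
  show "norm a \<le> onorm (left_mult (Unitization a 0))"
  proof (cases "a = 0")
    case True
    then show ?thesis by (simp add: onorm_pos_le bounded_linear_left_mult)
  next
    case False
    have "norm a * norm a = norm (star (star a) * star a)"
      by (simp only: norm_star_mult_self norm_star power2_eq_square)
    also have "\<dots> \<le> onorm (left_mult (Unitization a 0)) * norm a"
      using norm_left_mult_le[of "Unitization a 0" "star a"] by (simp add: left_mult_def star_star)
    finally show ?thesis using False by simp
  qed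
qed

instantiation unitization :: (cstar_algebra) real_normed_algebra_1
begin

definition norm_unitization :: "'a unitization \<Rightarrow> real"
  where "norm z = max (onorm (left_mult z)) (cmod (scalar_part z))"
definition "dist z w = norm (z - w :: 'a unitization)"
definition "sgn z = inverse (norm z) *\<^sub>R (z :: 'a unitization)"
definition "uniformity = (INF e\<in>{0 <..}. principal {(z, w :: 'a unitization). dist z w < e})"
definition "open U \<longleftrightarrow> (\<forall>z\<in>U. \<forall>\<^sub>F (z', w) in uniformity. z' = z \<longrightarrow> (w :: 'a unitization) \<in> U)"

instance
proof
  fix z w :: "'a unitization" and r :: real
  show "dist z w = norm (z - w)" by (rule dist_unitization_def)
  show "sgn z = inverse (norm z) *\<^sub>R z" by (rule sgn_unitization_def)
  show "(r *\<^sub>R z) * w = r *\<^sub>R (z * w)"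
    by (auto intro!: unitization.expand simp: scaleR_right_distrib scaleC_scaleR scaleR_scaleC)
  show "z * (r *\<^sub>R w) = r *\<^sub>R (z * w)"
    by (auto intro!: unitization.expand simp: scaleR_right_distrib scaleC_scaleR scaleR_scaleC)
  show "norm (z + w) \<le> norm z + norm w"
  proof -
    have "onorm (left_mult (z + w)) \<le> onorm (left_mult z) + onorm (left_mult w)"
      unfolding left_mult_add by (intro onorm_triangle bounded_linear_left_mult)
    moreover have "cmod (scalar_part (z + w)) \<le> cmod (scalar_part z) + cmod (scalar_part w)"
      by (simp add: norm_triangle_ineq)
    ultimately show ?thesis unfolding norm_unitization_def by linarith
  qed
  show "norm (r *\<^sub>R z) = \<bar>r\<bar> * norm z"
  proof -
    have "onorm (left_mult (r *\<^sub>R z)) = \<bar>r\<bar> * onorm (left_mult z)"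
      unfolding left_mult_scaleR by (rule onorm_scaleR[OF bounded_linear_left_mult])
    then show ?thesis
      unfolding norm_unitization_def unitization_scale_parts norm_scaleR
      by (metis max_mult_distrib_left abs_ge_zero)
  qed
  show "norm (z * w) \<le> norm z * norm w"
  proof -
    have "onorm (left_mult (z * w)) \<le> onorm (left_mult z) * onorm (left_mult w)"
      unfolding left_mult_mult by (intro onorm_compose bounded_linear_left_mult)
    also have "\<dots> \<le> norm z * norm w"
      by (intro mult_mono) (auto simp: norm_unitization_def onorm_pos_le bounded_linear_left_mult le_max_iff_disj)
    finally have 1: "onorm (left_mult (z * w)) \<le> norm z * norm w" .
    have "cmod (scalar_part (z * w)) \<le> norm z * norm w"
      unfolding unitization_parts norm_mult
      by (intro mult_mono) (auto simp: norm_unitization_def le_max_iff_disj)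
    with 1 show ?thesis by (simp add: norm_unitization_def[of "z * w"])
  qed
  show "norm z = 0 \<longleftrightarrow> z = 0"
  proof
    assume "norm z = 0"
    then have *: "onorm (left_mult z) \<le> 0" "cmod (scalar_part z) \<le> 0"
      unfolding norm_unitization_def by linarith+
    then have "z = Unitization (algebra_part z) 0" by (auto intro: unitization.expand)
    moreover have "algebra_part z = 0"
      using *(1) onorm_left_mult_algebra[of "algebra_part z"] calculation by simp
    ultimately show "z = 0" by (simp add: zero_unitization_def)
  next
    assume "z = 0"
    then show "norm z = 0"
      using onorm_left_mult_algebra[of "0 :: 'a"]
      by (simp add: norm_unitization_def zero_unitization_def)
  qed
  show "norm (1 :: 'a unitization) = 1"
  proof -
    have "onorm (left_mult (1 :: 'a unitization)) \<le> 1"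
      by (rule onorm_bound) (auto simp: left_mult_def)
    then show ?thesis by (simp add: norm_unitization_def)
  qed
qed (rule uniformity_unitization_def open_unitization_def)+

end

lemma norm_Unitization_algebra [simp]: "norm (Unitization a 0) = norm (a :: 'a::cstar_algebra)"
  by (simp add: norm_unitization_def onorm_left_mult_algebra)

instance unitization :: (cstar_algebra) banach
proof
  fix X :: "nat \<Rightarrow> 'a unitization"
  assume X: "Cauchy X"
  have scalar: "cmod (scalar_part z) \<le> norm z" for z :: "'a unitization"
    by (simp add: norm_unitization_def)
  \<comment> \<open>Both coordinates are bounded, so a Cauchy sequence converges coordinatewise.\<close>
  have alg: "norm (algebra_part z) \<le> 2 * norm z" for z :: "'a unitization"
  proof -
    have "onorm (left_mult (Unitization (algebra_part z) 0)) \<le> 2 * norm z"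
    proof (rule onorm_bound)
      fix x
      have "left_mult (Unitization (algebra_part z) 0) x = left_mult z x - scalar_part z *\<^sub>C x"
        by (simp add: left_mult_def)
      then have "norm (left_mult (Unitization (algebra_part z) 0) x)
          \<le> onorm (left_mult z) * norm x + cmod (scalar_part z) * norm x"
        using norm_triangle_ineq4[of "left_mult z x" "scalar_part z *\<^sub>C x"] norm_left_mult_le[of z x]
        by (simp add: norm_scaleC)
      also have "\<dots> \<le> norm z * norm x + norm z * norm x"
        by (intro add_mono mult_right_mono) (auto simp: norm_unitization_def)
      finally show "norm (left_mult (Unitization (algebra_part z) 0) x) \<le> 2 * norm z * norm x"
        by (simp only: mult_2 distrib_right)
    qed simp
    then show ?thesis by (simp add: onorm_left_mult_algebra)
  qed
  have bl_scalar: "bounded_linear (scalar_part :: 'a unitization \<Rightarrow> complex)"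
    by (rule bounded_linear_intro[where K = 1]) (auto simp: scalar)
  have bl_alg: "bounded_linear (algebra_part :: 'a unitization \<Rightarrow> 'a)"
    by (rule bounded_linear_intro[where K = 2]) (auto simp: alg mult.commute[of _ 2])
  obtain a where a: "(\<lambda>n. algebra_part (X n)) \<longlonglongrightarrow> a"
    using bounded_linear.Cauchy[OF bl_alg X] Cauchy_convergent convergent_def by blast
  obtain c where c: "(\<lambda>n. scalar_part (X n)) \<longlonglongrightarrow> c"
    using bounded_linear.Cauchy[OF bl_scalar X] Cauchy_convergent convergent_def by blast
  have bound: "norm z \<le> norm (algebra_part z) + cmod (scalar_part z)" for z :: "'a unitization"
  proof -
    have "onorm (left_mult z) \<le> norm (algebra_part z) + cmod (scalar_part z)"
    proof (rule onorm_bound)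
      fix x
      have "norm (left_mult z x) \<le> norm (algebra_part z * x) + norm (scalar_part z *\<^sub>C x)"
        unfolding left_mult_def by (rule norm_triangle_ineq)
      also have "\<dots> \<le> norm (algebra_part z) * norm x + cmod (scalar_part z) * norm x"
        by (intro add_mono norm_mult_ineq) (simp add: norm_scaleC)
      finally show "norm (left_mult z x) \<le> (norm (algebra_part z) + cmod (scalar_part z)) * norm x"
        by (simp add: distrib_right)
    qed simp
    then show ?thesis by (simp add: norm_unitization_def)
  qed
  have "(\<lambda>n. norm (algebra_part (X n) - a) + cmod (scalar_part (X n) - c)) \<longlonglongrightarrow> 0"
    using tendsto_add[OF tendsto_norm_zero[OF LIM_zero[OF a]] tendsto_norm_zero[OF LIM_zero[OF c]]]
    by simp
  then have "(\<lambda>n. norm (X n - Unitization a c)) \<longlonglongrightarrow> 0"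
  proof (rule Lim_null_comparison[rotated])
    have "norm (X n - Unitization a c) \<le> norm (algebra_part (X n) - a) + cmod (scalar_part (X n) - c)" for n
      using bound[of "X n - Unitization a c"] by (simp only: unitization_parts unitization.sel)
    then show "\<forall>\<^sub>F n in sequentially. norm (norm (X n - Unitization a c))
        \<le> norm (algebra_part (X n) - a) + cmod (scalar_part (X n) - c)"
      by simp
  qed
  then have "X \<longlonglongrightarrow> Unitization a c"
    by (rule LIM_zero_cancel[OF tendsto_norm_zero_cancel])
  then show "convergent X" by (auto simp: convergent_def)
qed

class unital_cstar_algebra = cstar_algebra + real_normed_algebra_1

instantiation unitization :: (cstar_algebra) unital_cstar_algebra
begin

definition star_unitization :: "'a unitization \<Rightarrow> 'a unitization"
  where "star z = Unitization (star (algebra_part z)) (cnj (scalar_part z))"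

instance
proof
  fix z w :: "'a unitization" and c :: complex
  show sz: "star (star z) = z" for z :: "'a unitization"
    by (simp add: star_unitization_def star_star)
  show "norm (c *\<^sub>C z) = cmod c * norm z"
  proof -
    have le: "norm (c *\<^sub>C z) \<le> cmod c * norm z" for c and z :: "'a unitization"
    proof -
      have "onorm (left_mult (c *\<^sub>C z)) \<le> cmod c * norm z"
      proof (rule onorm_bound)
        fix x
        have "norm (left_mult (c *\<^sub>C z) x) \<le> cmod c * (onorm (left_mult z) * norm x)"
          unfolding left_mult_scaleC norm_scaleC by (intro mult_left_mono norm_left_mult_le) simp
        also have "\<dots> \<le> cmod c * (norm z * norm x)"
          by (intro mult_left_mono mult_right_mono) (auto simp: norm_unitization_def)
        finally show "norm (left_mult (c *\<^sub>C z) x) \<le> cmod c * norm z * norm x" by simp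
      qed simp
      moreover have "cmod (scalar_part (c *\<^sub>C z)) \<le> cmod c * norm z"
        by (simp add: norm_mult norm_unitization_def mult_left_mono)
      ultimately show ?thesis by (simp add: norm_unitization_def[of "c *\<^sub>C z"])
    qed
    show ?thesis
    proof (cases "c = 0")
      case False
      have "cmod c * norm z = cmod c * norm (inverse c *\<^sub>C (c *\<^sub>C z))"
        using False by (simp add: scaleC_scaleC)
      also have "\<dots> \<le> cmod c * (cmod (inverse c) * norm (c *\<^sub>C z))"
        by (intro mult_left_mono le) simp
      also have "\<dots> = norm (c *\<^sub>C z)"
        using False by (simp add: norm_inverse)
      finally show ?thesis using le[of c z] by simp
    qed simp
  qed
  show "(c *\<^sub>C z) * w = c *\<^sub>C (z * w)" "z * (c *\<^sub>C w) = c *\<^sub>C (z * w)"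
    by (auto intro!: unitization.expand simp: scaleC_add_right scaleC_scaleC mult_scaleC_left
        mult_scaleC_right mult_ac)
  show "star (z + w) = star z + star w" "star (c *\<^sub>C z) = cnj c *\<^sub>C star z"
    by (auto intro!: unitization.expand simp: star_unitization_def star_add star_scaleC)
  show sm: "star (z * w) = star w * star z" for z w :: "'a unitization"
    by (auto intro!: unitization.expand simp: star_unitization_def star_add star_scaleC star_mult
        algebra_simps)
  \<comment> \<open>This inequality implies the C*-identity: it yields that the involution is isometric, hence
    the reverse inequality by submultiplicativity.\<close>
  have sq: "(norm z)\<^sup>2 \<le> norm (star z * z)" for z :: "'a unitization"
  proof -
    let ?N = "onorm (left_mult (star z * z))"
    \<comment> \<open>With the form that sends \<open>x\<close> and \<open>y\<close> to \<open>star x * y\<close>, the adjoint of left multiplication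
      by \<open>z\<close> is left multiplication by \<open>star z\<close>; this is the usual estimate for operators.\<close>
    have adjoint: "star (left_mult z x) * y = star x * left_mult (star z) y" for x y
      by (simp add: left_mult_def star_unitization_def star_add star_mult star_scaleC
          mult_scaleC_left mult_scaleC_right algebra_simps)
    have N: "0 \<le> ?N" by (simp add: onorm_pos_le bounded_linear_left_mult)
    have "onorm (left_mult z) \<le> sqrt ?N"
    proof (rule onorm_bound)
      fix x
      have "(norm (left_mult z x))\<^sup>2 = norm (star x * left_mult (star z * z) x)"
        unfolding norm_star_mult_self[symmetric] adjoint left_mult_mult by simp
      also have "\<dots> \<le> norm (star x) * (?N * norm x)"
        by (rule order_trans[OF norm_mult_ineq mult_left_mono[OF norm_left_mult_le norm_ge_zero]])
      also have "\<dots> = (sqrt ?N * norm x)\<^sup>2"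
        using N by (simp add: power_mult_distrib power2_eq_square)
      finally show "norm (left_mult z x) \<le> sqrt ?N * norm x"
        by (rule power2_le_imp_le) (use N in simp)
    qed (use N in simp)
    then have "(onorm (left_mult z))\<^sup>2 \<le> (sqrt ?N)\<^sup>2"
      by (rule power_mono) (rule onorm_pos_le[OF bounded_linear_left_mult])
    then have "(onorm (left_mult z))\<^sup>2 \<le> ?N" using N by simp
    moreover have "(cmod (scalar_part z))\<^sup>2 = cmod (scalar_part (star z * z))"
      by (simp add: star_unitization_def norm_mult power2_eq_square)
    ultimately show ?thesis
      unfolding norm_unitization_def by (simp add: max_def)
  qed
  have le: "norm z \<le> norm (star z)" for z :: "'a unitization"
  proof (cases "z = 0")
    case False
    have "norm z * norm z \<le> norm (star z) * norm z"
      using order_trans[OF sq norm_mult_ineq, of z] by (simp add: power2_eq_square)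
    with False show ?thesis by simp
  qed simp
  have "norm (star z * z) \<le> norm (star z) * norm z" by (rule norm_mult_ineq)
  also have "\<dots> \<le> norm z * norm z" using le[of "star z"] by (simp add: sz mult_right_mono)
  finally show "norm (star z * z) = (norm z)\<^sup>2"
    using sq[of z] by (simp add: power2_eq_square)
qed

end

section \<open>Positive elements of a unital C*-algebra\<close>

text \<open>A fixed point \<open>y = (x + y\<^sup>2) / 2\<close> satisfies \<open>(1 - y)\<^sup>2 = 1 - x\<close>. Iterating from \<open>0\<close> finds
  it even in the boundary case \<open>\<parallel>x\<parallel> = 1\<close>, where the map is not a contraction: every step is
  dominated by the corresponding step for the real number \<open>x = 1\<close>, whose iterates increase to \<open>1\<close>.\<close>

fun visser_iterate :: "'a \<Rightarrow> nat \<Rightarrow> 'a::real_normed_algebra"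
  where "visser_iterate x 0 = 0"
  | "visser_iterate x (Suc n) = (1/2) *\<^sub>R (x + visser_iterate x n * visser_iterate x n)"

lemma visser_iterate_one_bounds:
  "0 \<le> visser_iterate (1::real) n \<and> visser_iterate (1::real) n \<le> 1"
proof (induction n)
  case (Suc n)
  then have "visser_iterate (1::real) n * visser_iterate 1 n \<le> 1" by (simp add: mult_le_one)
  then show ?case by simp
qed simp

lemma norm_visser_iterate_le:
  assumes "norm x \<le> 1"
  shows "norm (visser_iterate x n) \<le> visser_iterate 1 n"
proof (induction n)
  case (Suc n)
  have "norm (x + visser_iterate x n * visser_iterate x n) \<le> 1 + visser_iterate 1 n * visser_iterate 1 n"
    by (intro order_trans[OF norm_triangle_ineq] add_mono assms
        order_trans[OF norm_mult_ineq] mult_mono Suc.IH) (simp_all add: visser_iterate_one_bounds)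
  then show ?case by simp
qed simp

lemma norm_visser_iterate_step:
  assumes "norm x \<le> 1"
  shows "norm (visser_iterate x (Suc n) - visser_iterate x n) \<le> visser_iterate 1 (Suc n) - visser_iterate 1 n"
proof (induction n)
  case 0
  then show ?case using assms by simp
next
  case (Suc n)
  let ?a = "visser_iterate x (Suc n)" and ?b = "visser_iterate x n"
  let ?s = "visser_iterate (1::real) (Suc n)" and ?t = "visser_iterate (1::real) n"
  have "visser_iterate x (Suc (Suc n)) - ?a = (1/2) *\<^sub>R (?a * (?a - ?b) + (?a - ?b) * ?b)"
    unfolding visser_iterate.simps(2)[of x "Suc n"] visser_iterate.simps(2)[of x n, symmetric]
    by (subst (3) visser_iterate.simps(2))
      (simp only: scaleR_diff_right[symmetric] right_diff_distrib left_diff_distrib, simp)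
  also have "norm \<dots> \<le> (1/2) * (?s * (?s - ?t) + (?s - ?t) * ?t)"
    unfolding norm_scaleR
    by (intro mult_mono order_trans[OF norm_triangle_ineq] add_mono order_trans[OF norm_mult_ineq]
        Suc.IH norm_visser_iterate_le[OF assms])
      (use visser_iterate_one_bounds order_trans[OF norm_ge_zero Suc.IH] in simp_all)
  also have "\<dots> = visser_iterate 1 (Suc (Suc n)) - ?s"
    by (simp add: algebra_simps)
  finally show ?case .
qed

lemma convergent_visser_iterate:
  fixes x :: "'a::{real_normed_algebra, banach}"
  assumes "norm x \<le> 1"
  shows "convergent (visser_iterate x)"
proof -
  have inc: "incseq (visser_iterate (1::real))"
    using norm_visser_iterate_step[of "1::real"] order_trans[OF norm_ge_zero]
    by (intro incseq_SucI) fastforce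
  obtain l where "visser_iterate (1::real) \<longlonglongrightarrow> l"
    using incseq_convergent[OF inc, of 1] visser_iterate_one_bounds by blast
  then have "summable (\<lambda>n. visser_iterate (1::real) (Suc n) - visser_iterate 1 n)"
    by (rule telescope_summable)
  then have "summable (\<lambda>n. visser_iterate x (Suc n) - visser_iterate x n)"
    by (rule summable_comparison_test'[where N = 0]) (rule norm_visser_iterate_step[OF assms])
  then show ?thesis
    unfolding summable_iff_convergent sum_lessThan_telescope by simp
qed

text \<open>The iterates are polynomials in \<open>x\<close>, so the limit inherits selfadjointness and commutes with
  everything that commutes with \<open>x\<close>.\<close>

lemma selfadjoint_square_root_one_minus:
  fixes x :: "'a::unital_cstar_algebra"
  assumes "norm x \<le> 1" and "star x = x"
  obtains y where "star y = y" "norm y \<le> 1" "(1 - y) * (1 - y) = 1 - x"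
    "\<And>z. z * x = x * z \<Longrightarrow> z * y = y * z"
proof -
  let ?v = "visser_iterate x"
  obtain y where y: "?v \<longlonglongrightarrow> y"
    using convergent_visser_iterate[OF assms(1)] by (auto simp: convergent_def)
  have "star (?v n) = ?v n" for n
    by (induction n) (simp_all add: star_add star_mult assms(2))
  then have "star y = y"
    using LIMSEQ_unique[OF bounded_linear.tendsto[OF bounded_linear_star y]] y by simp
  moreover have "norm y \<le> 1"
    by (rule LIMSEQ_le_const2[OF tendsto_norm[OF y]])
      (use norm_visser_iterate_le[OF assms(1)] visser_iterate_one_bounds order_trans in blast)
  moreover have "(1 - y) * (1 - y) = 1 - x"
  proof -
    have "(\<lambda>n. ?v (Suc n)) \<longlonglongrightarrow> (1/2) *\<^sub>R (x + y * y)"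
      unfolding visser_iterate.simps by (intro tendsto_intros y)
    then have "y = (1/2) *\<^sub>R (x + y * y)"
      using LIMSEQ_unique[OF LIMSEQ_Suc[OF y]] by blast
    then have "2 *\<^sub>R y = x + y * y" by (metis divideR_right zero_neq_numeral inverse_eq_divide)
    then show ?thesis by (simp add: algebra_simps scaleR_2)
  qed
  moreover have "z * y = y * z" if z: "z * x = x * z" for z
  proof -
    have "z * ?v n = ?v n * z" for n
      by (induction n) (simp_all add: z distrib_left distrib_right, metis mult.assoc)
    then show ?thesis
      using LIMSEQ_unique[OF tendsto_mult_left[OF y, of z]] tendsto_mult_right[OF y, of z] by simp
  qed
  ultimately show thesis by (rule that)
qed

text \<open>For selfadjoint \<open>h\<close> the bound \<open>\<parallel>\<beta> - h\<parallel> \<le> \<beta>\<close> says that the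
  spectrum lies in \<open>[0, 2 \<beta>]\<close>. In this form it is obvious that sums of positive elements
  are positive.\<close>

definition spectrally_positive :: "'a::unital_cstar_algebra \<Rightarrow> bool"
  where "spectrally_positive h \<longleftrightarrow> star h = h \<and> (\<exists>\<beta>\<ge>0. norm (\<beta> *\<^sub>R 1 - h) \<le> \<beta>)"

lemma star_one [simp]: "star (1 :: 'a::unital_cstar_algebra) = 1"
  by (metis mult_1 mult_1_right star_mult star_star)

lemma spectrally_positiveI:
  "star h = h \<Longrightarrow> 0 \<le> \<beta> \<Longrightarrow> norm (\<beta> *\<^sub>R 1 - h) \<le> \<beta> \<Longrightarrow> spectrally_positive h"
  unfolding spectrally_positive_def by blast

lemma spectrally_positive_selfadjoint: "spectrally_positive h \<Longrightarrow> star h = h"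
  unfolding spectrally_positive_def by blast

lemma spectrally_positive_add:
  assumes "spectrally_positive h" "spectrally_positive k"
  shows "spectrally_positive (h + k)"
proof -
  obtain \<beta> \<gamma> where "0 \<le> \<beta>" "norm (\<beta> *\<^sub>R 1 - h) \<le> \<beta>" "0 \<le> \<gamma>" "norm (\<gamma> *\<^sub>R 1 - k) \<le> \<gamma>"
    using assms unfolding spectrally_positive_def by blast
  then have "norm ((\<beta> *\<^sub>R 1 - h) + (\<gamma> *\<^sub>R 1 - k)) \<le> \<beta> + \<gamma>"
    by (intro order_trans[OF norm_triangle_ineq] add_mono)
  then show ?thesis
    using assms \<open>0 \<le> \<beta>\<close> \<open>0 \<le> \<gamma>\<close>
    by (intro spectrally_positiveI[where \<beta> = "\<beta> + \<gamma>"])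
      (simp_all add: star_add spectrally_positive_selfadjoint algebra_simps)
qed

lemma spectrally_positive_scaleR:
  assumes "spectrally_positive h" "0 \<le> r"
  shows "spectrally_positive (r *\<^sub>R h)"
proof -
  obtain \<beta> where \<beta>: "0 \<le> \<beta>" "norm (\<beta> *\<^sub>R 1 - h) \<le> \<beta>"
    using assms unfolding spectrally_positive_def by blast
  have "norm (r *\<^sub>R (\<beta> *\<^sub>R 1 - h)) \<le> r * \<beta>"
    unfolding norm_scaleR using \<beta> assms(2) by (simp add: mult_left_mono)
  then show ?thesis
    using \<beta> assms
    by (intro spectrally_positiveI[where \<beta> = "r * \<beta>"])
      (simp_all add: spectrally_positive_selfadjoint scaleR_diff_right)
qed

text \<open>The root is obtained from the root of \<open>1 - x\<close> with \<open>x = 1 - h / \<beta>\<close>. It is positive because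
  it is a nonnegative multiple of \<open>1 - y\<close> with \<open>\<parallel>y\<parallel> \<le> 1\<close>.\<close>

lemma spectrally_positive_square_root:
  assumes "spectrally_positive h"
  obtains k where "spectrally_positive k" "k * k = h" "\<And>z. z * h = h * z \<Longrightarrow> z * k = k * z"
proof -
  obtain \<beta> where \<beta>: "0 \<le> \<beta>" "norm (\<beta> *\<^sub>R 1 - h) \<le> \<beta>" and h: "star h = h"
    using assms unfolding spectrally_positive_def by blast
  show thesis
  proof (cases "\<beta> = 0")
    case True
    then have "h = 0" using \<beta> by simp
    then show thesis using assms by (intro that[of 0]) simp_all
  next
    case False
    with \<beta> have "0 < \<beta>" by simp
    define x where "x = 1 - (1/\<beta>) *\<^sub>R h"
    have "norm ((1/\<beta>) *\<^sub>R (\<beta> *\<^sub>R 1 - h)) \<le> 1"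
      unfolding norm_scaleR using \<beta> \<open>0 < \<beta>\<close> by (simp add: divide_simps)
    then have "norm x \<le> 1" using \<open>0 < \<beta>\<close> by (simp add: x_def scaleR_diff_right)
    moreover have "star x = x" by (simp add: x_def star_diff h)
    ultimately obtain y where y: "star y = y" "norm y \<le> 1" "(1 - y) * (1 - y) = 1 - x"
      "\<And>z. z * x = x * z \<Longrightarrow> z * y = y * z"
      by (rule selfadjoint_square_root_one_minus) blast
    show thesis
    proof (rule that[of "sqrt \<beta> *\<^sub>R (1 - y)"])
      show "spectrally_positive (sqrt \<beta> *\<^sub>R (1 - y))"
        using y by (intro spectrally_positive_scaleR spectrally_positiveI[where \<beta> = 1])
          (simp_all add: star_diff \<beta>)
      show "(sqrt \<beta> *\<^sub>R (1 - y)) * (sqrt \<beta> *\<^sub>R (1 - y)) = h"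
        using \<open>0 < \<beta>\<close> by (simp add: y(3) x_def)
      show "z * (sqrt \<beta> *\<^sub>R (1 - y)) = sqrt \<beta> *\<^sub>R (1 - y) * z" if "z * h = h * z" for z
      proof -
        have "z * x = x * z" using that by (simp add: x_def algebra_simps)
        from y(4)[OF this] show ?thesis by (simp add: algebra_simps)
      qed
    qed
  qed
qed

text \<open>Norm estimates for a selfadjoint \<open>q\<close> come from a commuting selfadjoint \<open>r\<close> for which
  \<open>q\<^sup>2 + r\<^sup>2\<close> is a scalar: then \<open>q + \<i> r\<close> is a multiple of a unitary, whose norm is known, and
  \<open>q\<close> is its real part.\<close>

lemma star_add_imaginary_mult_self:
  fixes q r :: "'a::cstar_algebra"
  assumes "star q = q" "star r = r" "q * r = r * q"
  shows "star (q + \<i> *\<^sub>C r) * (q + \<i> *\<^sub>C r) = q * q + r * r"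
  by (simp add: star_add star_scaleC assms scaleC_minus_left distrib_left left_diff_distrib
      mult_scaleC_left mult_scaleC_right scaleC_imaginary_imaginary scaleC_diff_right)

lemma norm_le_norm_add_imaginary:
  fixes q r :: "'a::cstar_algebra"
  assumes "star q = q" "star r = r"
  shows "norm q \<le> norm (q + \<i> *\<^sub>C r)"
proof -
  let ?u = "q + \<i> *\<^sub>C r"
  have "?u + star ?u = 2 *\<^sub>R q"
    by (simp add: star_add star_scaleC assms scaleC_minus_left scaleR_2)
  then have "2 * norm q \<le> 2 * norm ?u"
    using norm_triangle_ineq[of ?u "star ?u"] by (simp del: star_add)
  then show ?thesis by simp
qed

lemma norm_selfadjoint_square:
  "star q = q \<Longrightarrow> norm (q * q) = (norm (q :: 'a::cstar_algebra))\<^sup>2"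
  by (metis norm_star_mult_self)

text \<open>For \<open>\<parallel>k\<parallel> \<le> 1\<close> the selfadjoint \<open>r = (1 - k\<^sup>2)\<^sup>1\<^sup>/\<^sup>2\<close> is the real part of the unitary
  \<open>r + \<i> k\<close>, so \<open>\<parallel>1 - k\<^sup>2\<parallel> = \<parallel>r\<parallel>\<^sup>2 \<le> 1\<close>. The general case follows by scaling. This is what
  makes squares of selfadjoint elements positive.\<close>

lemma norm_square_diff_le:
  fixes k :: "'a::unital_cstar_algebra"
  assumes "star k = k"
  shows "norm ((norm k)\<^sup>2 *\<^sub>R 1 - k * k) \<le> (norm k)\<^sup>2"
proof -
  have contraction: "norm (1 - k * k) \<le> 1" if k: "star k = k" "norm k \<le> 1" for k :: 'a
  proof -
    have "norm (k * k) \<le> 1" using k by (simp add: norm_selfadjoint_square power_le_one)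
    moreover have "star (k * k) = k * k" by (simp add: star_mult k)
    ultimately obtain y where y: "star y = y" "(1 - y) * (1 - y) = 1 - k * k"
      "\<And>z. z * (k * k) = k * k * z \<Longrightarrow> z * y = y * z"
      by (rule selfadjoint_square_root_one_minus) blast
    have "(1 - y) * k = k * (1 - y)"
      using y(3)[of k] by (simp add: algebra_simps)
    then have "star ((1 - y) + \<i> *\<^sub>C k) * ((1 - y) + \<i> *\<^sub>C k) = 1"
      using star_add_imaginary_mult_self[of "1 - y" k] by (simp add: star_diff y k)
    then have "(norm ((1 - y) + \<i> *\<^sub>C k))\<^sup>2 = 1"
      using norm_star_mult_self[of "(1 - y) + \<i> *\<^sub>C k"] by simp
    then have "norm ((1 - y) + \<i> *\<^sub>C k) \<le> 1"
      by (auto simp: power2_eq_1_iff)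
    then have "norm (1 - y) \<le> 1"
      using norm_le_norm_add_imaginary[of "1 - y" k] k y by (simp add: star_diff)
    then show ?thesis
      using norm_selfadjoint_square[of "1 - y"] y by (simp add: star_diff power_le_one)
  qed
  show ?thesis
  proof (cases "k = 0")
    case False
    then have n: "0 < norm k" by simp
    define k' where "k' = (1 / norm k) *\<^sub>R k"
    have "norm (1 - k' * k') \<le> 1"
      using n by (intro contraction) (simp_all add: k'_def assms)
    moreover have "(norm k)\<^sup>2 *\<^sub>R 1 - k * k = (norm k)\<^sup>2 *\<^sub>R (1 - k' * k')"
      using n by (simp add: k'_def scaleR_diff_right power2_eq_square)
    ultimately show ?thesis by (simp add: mult_left_le)
  qed simp
qed

lemma spectrally_positive_square:
  "star k = k \<Longrightarrow> spectrally_positive (k * k)"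
  by (rule spectrally_positiveI[OF _ _ norm_square_diff_le]) (simp_all add: star_mult)

lemma norm_diff_spectrally_positive_le:
  assumes "spectrally_positive h"
  shows "norm (norm h *\<^sub>R 1 - h) \<le> norm h"
proof -
  obtain k where "spectrally_positive k" "k * k = h"
    using spectrally_positive_square_root[OF assms] by metis
  then show ?thesis
    using norm_square_diff_le[of k] norm_selfadjoint_square[of k]
    by (simp add: spectrally_positive_selfadjoint)
qed

text \<open>With \<open>\<beta> = \<parallel>h + k\<parallel>\<close> one has \<open>\<beta> - h = (\<beta> - (h + k)) + k\<close>, a sum of positive elements. So both
  \<open>h = q\<^sup>2\<close> and \<open>\<beta> - h = r\<^sup>2\<close> are squares of commuting elements, and \<open>q + \<i> r\<close> has norm \<open>\<beta>\<^sup>1\<^sup>/\<^sup>2\<close>.\<close>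

lemma norm_le_norm_add_spectrally_positive:
  assumes h: "spectrally_positive h" and k: "spectrally_positive k"
  shows "norm h \<le> norm (h + k)"
proof -
  let ?\<beta> = "norm (h + k)"
  have hk: "spectrally_positive (h + k)" by (rule spectrally_positive_add[OF h k])
  have "spectrally_positive (?\<beta> *\<^sub>R 1 - (h + k))"
    by (rule spectrally_positiveI[where \<beta> = ?\<beta>])
      (simp_all add: star_diff spectrally_positive_selfadjoint[OF hk] add.commute)
  from spectrally_positive_add[OF this k] have "spectrally_positive (?\<beta> *\<^sub>R 1 - h)"
    by (simp add: algebra_simps)
  then obtain r where r: "spectrally_positive r" "r * r = ?\<beta> *\<^sub>R 1 - h"
    "\<And>z. z * (?\<beta> *\<^sub>R 1 - h) = (?\<beta> *\<^sub>R 1 - h) * z \<Longrightarrow> z * r = r * z"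
    by (rule spectrally_positive_square_root) blast
  obtain q where q: "spectrally_positive q" "q * q = h" "\<And>z. z * h = h * z \<Longrightarrow> z * q = q * z"
    using spectrally_positive_square_root[OF h] by blast
  have sa: "star q = q" "star r = r"
    by (simp_all add: spectrally_positive_selfadjoint q r)
  have "q * h = h * q" unfolding q(2)[symmetric] by (simp add: mult.assoc)
  then have "q * r = r * q" by (intro r(3)) (simp add: algebra_simps)
  then have "star (q + \<i> *\<^sub>C r) * (q + \<i> *\<^sub>C r) = ?\<beta> *\<^sub>R 1"
    using star_add_imaginary_mult_self[OF sa] by (simp add: q(2) r(2))
  then have "(norm (q + \<i> *\<^sub>C r))\<^sup>2 = ?\<beta>"
    using norm_star_mult_self[of "q + \<i> *\<^sub>C r"] by simp
  moreover have "(norm q)\<^sup>2 \<le> (norm (q + \<i> *\<^sub>C r))\<^sup>2"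
    by (intro power_mono norm_le_norm_add_imaginary sa) simp
  moreover have "(norm q)\<^sup>2 = norm h"
    using norm_selfadjoint_square[OF sa(1)] q(2) by simp
  ultimately show ?thesis by simp
qed

text \<open>Let \<open>p = - d\<^sup>* d\<close> and \<open>g = d d\<^sup>*\<close>. Since \<open>d\<^sup>* d + d d\<^sup>*\<close> is a positive combination of squares
  of selfadjoint elements, \<open>g\<close> is positive too. The usual argument now compares the spectra
  of \<open>d\<^sup>* d\<close> and \<open>d d\<^sup>*\<close>. Here the identity \<open>d (N + p) = (N - g) d\<close> with \<open>N = \<parallel>d\<parallel>\<^sup>2\<close> replaces
  it: positivity of \<open>g\<close> makes the square of the norm of the right side at most \<open>N\<^sup>3\<close>, while
  positivity of \<open>p\<close> makes that of the left side at least \<open>2 N\<^sup>3\<close>.\<close>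

lemma zero_if_minus_star_mult_self_positive:
  fixes d :: "'a::unital_cstar_algebra"
  assumes p: "spectrally_positive (- (star d * d))"
  shows "d = 0"
proof -
  define p where "p = - (star d * d)"
  define g where "g = d * star d"
  define N where "N = (norm d)\<^sup>2"
  have pos_p: "spectrally_positive p" using p by (simp add: p_def)
  have dd: "star d * d = - p" by (simp add: p_def)

  \<comment> \<open>Twice the real and the imaginary part of \<open>d\<close>.\<close>
  define x where "x = d + star d"
  define y where "y = \<i> *\<^sub>C (star d - d)"
  have "star x = x" "star y = y"
    by (simp_all add: x_def y_def star_add star_star star_scaleC star_diff scaleC_diff_right
        scaleC_minus_left add.commute)
  then have "spectrally_positive ((1/2) *\<^sub>R (x * x + y * y) + p)"
    by (intro spectrally_positive_add spectrally_positive_scaleR spectrally_positive_square pos_p) simp_all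
  moreover have "y * y = - ((star d - d) * (star d - d))"
    by (simp only: y_def mult_scaleC_left mult_scaleC_right scaleC_imaginary_imaginary)
  then have "x * x + y * y = 2 *\<^sub>R (g - p)"
    by (simp add: x_def g_def p_def algebra_simps scaleR_2)
  ultimately have pos_g: "spectrally_positive g" by simp
  have norm_p: "norm p = N" by (simp add: p_def N_def norm_star_mult_self)
  have norm_g: "norm g = N"
    using norm_star_mult_self[of "star d"] by (simp add: g_def N_def star_star)
  have sa_p: "star p = p" by (rule spectrally_positive_selfadjoint[OF pos_p])
  have N: "0 \<le> N" by (simp add: N_def)
  define w where "w = N *\<^sub>R 1 + p"
  have "d * w = (N *\<^sub>R 1 - g) * d"
    by (simp add: w_def p_def g_def algebra_simps mult.assoc)
  then have "norm (d * w) \<le> N * norm d"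
    using norm_diff_spectrally_positive_le[OF pos_g] norm_g
    by (metis norm_mult_ineq norm_ge_zero mult_right_mono order_trans)
  then have "(norm (d * w))\<^sup>2 \<le> (N * norm d)\<^sup>2"
    by (rule power_mono) simp
  then have upper: "(norm (d * w))\<^sup>2 \<le> N * N * N"
    by (simp add: power_mult_distrib N_def[symmetric] power2_eq_square[of N])
  have "star (d * w) * (d * w) = - (w * p * w)"
    by (simp add: star_mult w_def star_add sa_p dd mult.assoc[symmetric])
      (simp add: mult.assoc dd)
  also have "w * p * w = (2 * N) *\<^sub>R (p * p) + ((N * N) *\<^sub>R p + p * p * p)"
    by (simp add: w_def algebra_simps scaleR_add_left[symmetric])
  finally have "(norm (d * w))\<^sup>2 = norm ((2 * N) *\<^sub>R (p * p) + ((N * N) *\<^sub>R p + p * p * p))"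
    by (metis norm_minus_cancel norm_star_mult_self)
  moreover have "spectrally_positive (p * p * p)"
  proof -
    obtain k where k: "spectrally_positive k" "k * k = p"
      using spectrally_positive_square_root[OF pos_p] by blast
    have "p * p * p = (k * p) * (k * p)" unfolding k(2)[symmetric] by (simp add: mult.assoc)
    moreover have "star (k * p) = k * p"
      by (simp add: star_mult sa_p spectrally_positive_selfadjoint[OF k(1)] k(2)[symmetric] mult.assoc)
    ultimately show ?thesis using spectrally_positive_square by metis
  qed
  then have "norm ((2 * N) *\<^sub>R (p * p)) \<le> norm ((2 * N) *\<^sub>R (p * p) + ((N * N) *\<^sub>R p + p * p * p))"
    using N by (intro norm_le_norm_add_spectrally_positive spectrally_positive_add
        spectrally_positive_scaleR spectrally_positive_square pos_p sa_p) simp_all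
  moreover have "norm ((2 * N) *\<^sub>R (p * p)) = 2 * (N * N * N)"
    using norm_selfadjoint_square[OF sa_p] N by (simp add: norm_p power2_eq_square)
  ultimately have "N * N * N \<le> 0" using upper by linarith
  then have "N = 0" using N by (metis mult_eq_0_iff mult_nonneg_nonneg order_antisym)
  then show ?thesis by (simp add: N_def)
qed

text \<open>Let \<open>h = b\<^sup>* b\<close> and let \<open>r\<close> be its absolute value, the positive root of \<open>h\<^sup>2\<close>. Then
  \<open>v = r - h\<close>, twice the negative part of \<open>h\<close>, satisfies \<open>h v = - r v\<close>. Hence
  \<open>(b v)\<^sup>* (b v) = - v r v\<close>, which is the negative of a square because \<open>r\<close> has a positive root
  commuting with \<open>v\<close>. The previous lemma gives \<open>b v = 0\<close>, from which \<open>v = 0\<close> and \<open>h = r\<close>.\<close>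

theorem spectrally_positive_star_mult_self:
  fixes b :: "'a::unital_cstar_algebra"
  shows "spectrally_positive (star b * b)"
proof -
  define h where "h = star b * b"
  have sa_h: "star h = h" by (simp add: h_def star_mult star_star)
  obtain r where r: "spectrally_positive r" "r * r = h * h" "\<And>z. z * (h * h) = h * h * z \<Longrightarrow> z * r = r * z"
    using spectrally_positive_square_root[OF spectrally_positive_square[OF sa_h]] by blast
  have hr: "h * r = r * h" by (rule r(3)) (simp add: mult.assoc)
  define v where "v = r - h"
  have sa_v: "star v = v"
    by (simp add: v_def star_diff sa_h spectrally_positive_selfadjoint r(1))
  have hv: "h * v = - (r * v)" by (simp add: v_def right_diff_distrib r(2) hr)
  have vr: "v * r = r * v" by (simp add: v_def algebra_simps hr)
  obtain q where q: "spectrally_positive q" "q * q = r" "\<And>z. z * r = r * z \<Longrightarrow> z * q = q * z"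
    using spectrally_positive_square_root[OF r(1)] by blast
  have vq: "v * q = q * v" by (rule q(3)[OF vr])
  have sa_qv: "star (q * v) = q * v"
    by (simp add: star_mult sa_v spectrally_positive_selfadjoint q(1) vq)
  have "star (b * v) * (b * v) = v * (h * v)"
    by (simp add: star_mult sa_v h_def mult.assoc)
  also have "\<dots> = - ((q * v) * (q * v))"
    by (simp add: hv q(2)[symmetric] vq[symmetric] mult.assoc)
  finally have bv: "star (b * v) * (b * v) = - ((q * v) * (q * v))" .
  then have "b * v = 0"
    by (intro zero_if_minus_star_mult_self_positive)
      (simp add: spectrally_positive_square[OF sa_qv])
  then have "norm ((q * v) * (q * v)) = 0" using bv by simp
  then have "q * v = 0" by (simp add: norm_selfadjoint_square[OF sa_qv])
  then have rv: "r * v = 0" by (simp add: q(2)[symmetric] mult.assoc)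
  then have "v * v = 0" using hv by (simp add: v_def left_diff_distrib)
  then have "v = 0" using norm_selfadjoint_square[OF sa_v] by simp
  then show ?thesis using r(1) by (simp add: v_def h_def)
qed
section \<open>Positive elements of an arbitrary C*-algebra\<close>

lemma star_Unitization: "star (Unitization a c) = Unitization (star a) (cnj c)"
  by (simp add: star_unitization_def)

lemma Unitization_mult: "Unitization a 0 * Unitization b 0 = Unitization (a * b) (0 :: complex)"
  by (simp add: times_unitization_def)

lemma Unitization_add: "Unitization a 0 + Unitization b 0 = Unitization (a + b) (0 :: complex)"
  by (simp add: plus_unitization_def)

text \<open>A root taken in the unitization already lies in the algebra, because the square of its scalar
  part vanishes.\<close>

lemma cstar_positive_iff_unitization:
  "cstar_positive a \<longleftrightarrow> spectrally_positive (Unitization a 0)"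
proof
  assume "cstar_positive a"
  then obtain b where "a = star b * b" unfolding cstar_positive_def by blast
  then have "Unitization a 0 = star (Unitization b 0) * Unitization b 0"
    by (simp add: star_Unitization Unitization_mult)
  then show "spectrally_positive (Unitization a 0)"
    by (simp only: spectrally_positive_star_mult_self)
next
  assume "spectrally_positive (Unitization a 0)"
  then obtain k where k: "spectrally_positive k" "k * k = Unitization a 0"
    using spectrally_positive_square_root by blast
  have "scalar_part k * scalar_part k = 0"
    using arg_cong[OF k(2), of scalar_part] by simp
  then obtain b where b: "k = Unitization b 0" by (metis mult_eq_0_iff unitization.collapse)
  have "star b = b"
    using spectrally_positive_selfadjoint[OF k(1)] by (simp add: b star_Unitization)
  moreover have "b * b = a" using k(2) by (simp add: b Unitization_mult)
  ultimately show "cstar_positive a" unfolding cstar_positive_def by metis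
qed

lemma cstar_positive_add:
  "cstar_positive a \<Longrightarrow> cstar_positive b \<Longrightarrow> cstar_positive (a + b)"
  unfolding cstar_positive_iff_unitization Unitization_add[symmetric]
  by (rule spectrally_positive_add)

lemma norm_le_norm_add_cstar_positive:
  assumes "cstar_positive a" "cstar_positive b"
  shows "norm a \<le> norm (a + b)"
  using norm_le_norm_add_spectrally_positive[OF assms[unfolded cstar_positive_iff_unitization]]
  by (simp add: Unitization_add)

section \<open>Hilbert modules and their direct sums\<close>

context hilbert_module
begin

lemma ip_add_right: "ip x (y + z) = ip x y + ip x z"
  by (metis ip_add_left ip_star star_add)

lemma ip_scaleC_right: "ip x (c *\<^sub>C y) = cnj c *\<^sub>C ip x y"
  by (metis ip_scaleC_left ip_star star_scaleC)

lemma ip_zero_left [simp]: "ip 0 x = 0"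
  using ip_add_left[of 0 0 x] by simp

lemma ip_minus_left: "ip (- x) y = - ip x y"
  using ip_scaleC_left[of "- 1" x y] by (simp add: scaleC_minus_one)

lemma ip_minus_right: "ip x (- y) = - ip x y"
  using ip_scaleC_right[of x "- 1" y] by (simp add: scaleC_minus_one)

lemma norm_ip_self: "norm (ip x x) = (norm x)\<^sup>2"
  by (simp add: norm_eq)

lemma norm_module_scaleC:
  fixes x :: 'e
  shows "norm (c *\<^sub>C x) = cmod c * norm x"
proof -
  have "norm (ip (c *\<^sub>C x) (c *\<^sub>C x)) = (cmod c)\<^sup>2 * norm (ip x x)"
    by (simp add: ip_scaleC_left ip_scaleC_right norm_scaleC power2_eq_square)
  then have "(norm (c *\<^sub>C x))\<^sup>2 = (cmod c * norm x)\<^sup>2"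
    by (simp only: norm_ip_self power_mult_distrib)
  then show ?thesis by (simp add: power2_eq_iff_nonneg)
qed

lemma ip_polarization:
  "4 *\<^sub>R ip x y = (ip (x + y) (x + y) - ip (x + - y) (x + - y))
    + \<i> *\<^sub>C (ip (x + \<i> *\<^sub>C y) (x + \<i> *\<^sub>C y) - ip (x + - \<i> *\<^sub>C y) (x + - \<i> *\<^sub>C y))"
proof -
  have "ip (x + y) (x + y) - ip (x + - y) (x + - y) = 2 *\<^sub>R (ip x y + ip y x)"
    by (simp del: add_uminus_conv_diff
        add: ip_add_left ip_add_right ip_minus_left ip_minus_right scaleR_2)
  moreover have "ip (x + \<i> *\<^sub>C y) (x + \<i> *\<^sub>C y) - ip (x + - \<i> *\<^sub>C y) (x + - \<i> *\<^sub>C y)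
      = 2 *\<^sub>R (\<i> *\<^sub>C (ip y x - ip x y))"
    by (simp del: add_uminus_conv_diff
        add: ip_add_left ip_add_right ip_scaleC_left ip_scaleC_right scaleC_minus_left
        ip_minus_left ip_minus_right scaleC_add_right scaleC_diff_right scaleC_minus_right scaleR_2)
  ultimately show ?thesis
    by (simp add: scaleC_scaleR scaleC_imaginary_imaginary scaleR_right_diff_distrib
        scaleR_right_distrib flip: scaleR_add_left)
qed

text \<open>A weak form of the Cauchy-Schwarz inequality. It is immediate from polarization because
  the Hilbert-module norm is known to satisfy the triangle inequality, and it suffices
  for continuity of the inner product.\<close>

lemma norm_ip_le_square: "norm (ip x y) \<le> (norm x + norm y)\<^sup>2"
proof -
  have bound: "norm (ip (x + z) (x + z)) \<le> (norm x + norm y)\<^sup>2" if "norm z = norm y" for z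
    unfolding norm_ip_self that[symmetric] by (intro power_mono norm_triangle_ineq) simp
  have "norm (4 *\<^sub>R ip x y) \<le> ((norm x + norm y)\<^sup>2 + (norm x + norm y)\<^sup>2)
      + 1 * ((norm x + norm y)\<^sup>2 + (norm x + norm y)\<^sup>2)"
    unfolding ip_polarization
    by (intro order_trans[OF norm_triangle_ineq] add_mono order_trans[OF norm_triangle_ineq4]
        bound ord_eq_le_trans[OF norm_scaleC] mult_mono)
      (simp_all add: norm_module_scaleC add_nonneg_nonneg)
  then show ?thesis by simp
qed

lemma bounded_bilinear_ip: "bounded_bilinear ip"
proof
  fix x y z and r :: real
  show "ip (x + y) z = ip x z + ip y z" "ip x (y + z) = ip x y + ip x z"
    by (rule ip_add_left ip_add_right)+
  show left: "ip (r *\<^sub>R x) y = r *\<^sub>R ip x y" for r x y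
    using ip_scaleC_left[of "complex_of_real r" x y] by (simp add: scaleC_of_real)
  show right: "ip x (r *\<^sub>R y) = r *\<^sub>R ip x y" for r x y
    using ip_scaleC_right[of x "complex_of_real r" y] by (simp add: scaleC_of_real)
  have "norm (ip x y) \<le> norm x * norm y * 4" for x y
  proof (cases "x = 0 \<or> y = 0")
    case True
    then show ?thesis using right[of x 0 0] by auto
  next
    case False
    let ?x = "(1 / norm x) *\<^sub>R x" and ?y = "(1 / norm y) *\<^sub>R y"
    have "norm (ip x y) = norm x * norm y * norm (ip ?x ?y)"
      using False by (simp add: left right)
    also have "\<dots> \<le> norm x * norm y * 4"
      using norm_ip_le_square[of ?x ?y] False by (intro mult_left_mono) simp_all
    finally show ?thesis .
  qed
  then show "\<exists>K. \<forall>x y. norm (ip x y) \<le> norm x * norm y * K" by blast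
qed

lemma eq_zero_if_orth_dense:
  assumes "closure D = UNIV" "\<And>x. x \<in> D \<Longrightarrow> ip x z = 0"
  shows "z = 0"
proof -
  have "closed {x. ip x z = 0}"
    by (intro closed_Collect_eq linear_continuous_on continuous_on_const
        bounded_bilinear.bounded_linear_left bounded_bilinear_ip)
  then have "closure D \<subseteq> {x. ip x z = 0}"
    using assms(2) by (intro closure_minimal) auto
  then have "ip z z = 0" using assms(1) by auto
  then show ?thesis using norm_ip_self[of z] by simp
qed

end

locale hilbert_module_pair =
  E: hilbert_module actE ipE + F: hilbert_module actF ipF
  for actE :: "'a::cstar_algebra \<Rightarrow> 'e::{complex_vector, banach} \<Rightarrow> 'e"
    and ipE :: "'e \<Rightarrow> 'e \<Rightarrow> 'a"
    and actF :: "'a \<Rightarrow> 'f::{complex_vector, banach} \<Rightarrow> 'f"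
    and ipF :: "'f \<Rightarrow> 'f \<Rightarrow> 'a"
begin

abbreviation ips :: "'e \<times> 'f \<Rightarrow> 'e \<times> 'f \<Rightarrow> 'a"
  where "ips \<equiv> ip_sum ipE ipF"

lemma bounded_bilinear_ips: "bounded_bilinear ips"
proof -
  interpret E: bounded_bilinear ipE by (rule E.bounded_bilinear_ip)
  interpret F: bounded_bilinear ipF by (rule F.bounded_bilinear_ip)
  obtain K L where K: "0 \<le> K" "\<And>x y. norm (ipE x y) \<le> norm x * norm y * K"
    and L: "0 \<le> L" "\<And>x y. norm (ipF x y) \<le> norm x * norm y * L"
    using E.nonneg_bounded F.nonneg_bounded by metis
  have "norm (ips z w) \<le> norm z * norm w * (K + L)" for z w
  proof -
    have "norm (ips z w) \<le> norm (fst z) * norm (fst w) * K + norm (snd z) * norm (snd w) * L"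
      unfolding ip_sum_def by (intro order_trans[OF norm_triangle_ineq] add_mono K L)
    also have "\<dots> \<le> norm z * norm w * K + norm z * norm w * L"
      by (intro add_mono mult_mono) (simp_all add: K L norm_prod_def)
    finally show ?thesis by (simp add: distrib_left)
  qed
  then show ?thesis
    by (intro bounded_bilinear.intro exI[of _ "K + L"])
      (auto simp: ip_sum_def E.add_left E.add_right F.add_left F.add_right E.scaleR_left
        E.scaleR_right F.scaleR_left F.scaleR_right scaleR_right_distrib)
qed

lemma ips_star: "star (ips z w) = ips w z"
  by (simp add: ip_sum_def star_add E.ip_star F.ip_star)

lemma ips_orth_commute: "ips z w = 0 \<longleftrightarrow> ips w z = 0"
  by (metis ips_star star_zero)

lemma ips_positive: "cstar_positive (ips z z)"
  unfolding ip_sum_def by (intro cstar_positive_add E.ip_positive F.ip_positive)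

lemma norm_ips_self_le: "norm (ips z z) \<le> (norm z)\<^sup>2"
  using norm_triangle_ineq[of "ipE (fst z) (fst z)" "ipF (snd z) (snd z)"]
  by (simp add: ip_sum_def E.norm_ip_self F.norm_ip_self norm_prod_def)

text \<open>Together with the preceding estimate this compares the norm of the product type with the
  Hilbert-module norm of the direct sum, up to the factor \<open>sqrt 2\<close>.\<close>

lemma norm_square_le_norm_ips_self: "(norm z)\<^sup>2 \<le> 2 * norm (ips z z)"
proof -
  have "(norm (fst z))\<^sup>2 \<le> norm (ips z z)"
    unfolding ip_sum_def E.norm_ip_self[symmetric]
    by (rule norm_le_norm_add_cstar_positive[OF E.ip_positive F.ip_positive])
  moreover have "(norm (snd z))\<^sup>2 \<le> norm (ips z z)"
    unfolding ip_sum_def F.norm_ip_self[symmetric] add.commute[of "ipE _ _"]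
    by (rule norm_le_norm_add_cstar_positive[OF F.ip_positive E.ip_positive])
  ultimately show ?thesis by (simp add: norm_prod_def)
qed

lemma eq_zero_if_ips_self: "ips z z = 0 \<Longrightarrow> z = 0"
  using norm_square_le_norm_ips_self[of z] by simp

text \<open>The place where positivity in the algebra enters: \<open>\<langle>w + v, w + v\<rangle> = \<langle>w, w\<rangle> + \<langle>v, v\<rangle>\<close>, and adding
  a positive element does not decrease the norm.\<close>

lemma norm_le_norm_add_orth:
  assumes "ips v w = 0"
  shows "norm w \<le> sqrt 2 * norm (w + v)"
proof -
  interpret bounded_bilinear ips by (rule bounded_bilinear_ips)
  have "ips w v = 0" using assms ips_orth_commute by blast
  then have split: "ips (w + v) (w + v) = ips w w + ips v v"
    using assms by (simp add: add_left add_right)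
  have "(norm w)\<^sup>2 \<le> 2 * norm (ips w w)" by (rule norm_square_le_norm_ips_self)
  also have "\<dots> \<le> 2 * norm (ips (w + v) (w + v))"
    unfolding split by (intro mult_left_mono norm_le_norm_add_cstar_positive ips_positive) simp
  also have "\<dots> \<le> 2 * (norm (w + v))\<^sup>2"
    by (intro mult_left_mono norm_ips_self_le) simp
  finally show ?thesis
    by (rule power2_le_imp_le[OF ord_le_eq_trans]) (simp_all add: power_mult_distrib)
qed

lemma closed_orth_compl: "closed (orth_compl ips W)"
proof -
  have "closed {m. ips m w = 0}" for w
    by (intro closed_Collect_eq linear_continuous_on continuous_on_const
        bounded_bilinear.bounded_linear_left[OF bounded_bilinear_ips])
  moreover have "orth_compl ips W = (\<Inter>w\<in>W. {m. ips m w = 0})"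
    by (auto simp: orth_compl_def)
  ultimately show ?thesis by (simp add: closed_INT)
qed

lemma orth_compl_diff:
  "v \<in> orth_compl ips W \<Longrightarrow> v' \<in> orth_compl ips W \<Longrightarrow> v - v' \<in> orth_compl ips W"
  by (simp add: orth_compl_def bounded_bilinear.diff_left[OF bounded_bilinear_ips])

lemma orth_compl_inter:
  "w \<in> W \<Longrightarrow> w \<in> orth_compl ips W \<Longrightarrow> w = 0"
  by (auto simp: orth_compl_def intro: eq_zero_if_ips_self)

definition orth_sum :: "('e \<times> 'f) set \<Rightarrow> ('e \<times> 'f) set"
  where "orth_sum W = {w + v | w v. w \<in> W \<and> v \<in> orth_compl ips W}"

text \<open>In a convergent sequence of sums \<open>w + v\<close> the summands \<open>w\<close> form a Cauchy sequence by
  \<open>norm_le_norm_add_orth\<close>.\<close>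

lemma closed_orth_sum:
  assumes W: "closed W" "\<And>w w'. w \<in> W \<Longrightarrow> w' \<in> W \<Longrightarrow> w - w' \<in> W"
  shows "closed (orth_sum W)"
  unfolding closed_sequential_limits
proof (intro allI impI, elim conjE)
  fix m l
  assume m: "\<forall>n. m n \<in> orth_sum W" and lim: "m \<longlonglongrightarrow> l"
  from m have "\<forall>n. \<exists>w v. m n = w + v \<and> w \<in> W \<and> v \<in> orth_compl ips W"
    by (auto simp: orth_sum_def)
  then obtain w v where wv: "\<And>n. m n = w n + v n" "\<And>n. w n \<in> W" "\<And>n. v n \<in> orth_compl ips W"
    by metis
  have dist: "dist (w i) (w j) \<le> sqrt 2 * dist (m i) (m j)" for i j
  proof -
    have "ips (v i - v j) (w i - w j) = 0"
      using orth_compl_diff[OF wv(3) wv(3)] W(2)[OF wv(2) wv(2)] by (auto simp: orth_compl_def)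
    then show ?thesis
      using norm_le_norm_add_orth[of "v i - v j" "w i - w j"]
      by (simp add: dist_norm wv(1) algebra_simps)
  qed
  have "Cauchy w"
  proof (rule metric_CauchyI)
    fix e :: real
    assume "0 < e"
    then obtain M where "\<forall>i\<ge>M. \<forall>j\<ge>M. dist (m i) (m j) < e / sqrt 2"
      using metric_CauchyD[OF LIMSEQ_imp_Cauchy[OF lim], of "e / sqrt 2"] by auto
    then have "dist (w i) (w j) < e" if "i \<ge> M" "j \<ge> M" for i j
      using dist[of i j] that by (fastforce simp: field_simps)
    then show "\<exists>M. \<forall>i\<ge>M. \<forall>j\<ge>M. dist (w i) (w j) < e" by blast
  qed
  then obtain u where u: "w \<longlonglongrightarrow> u" using Cauchy_convergent convergent_def by blast
  have "u \<in> W" using closed_sequentially[OF W(1)] wv(2) u by blast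
  moreover have "v = (\<lambda>n. m n - w n)" using wv(1) by auto
  then have "v \<longlonglongrightarrow> l - u" using tendsto_diff[OF lim u] by simp
  then have "l - u \<in> orth_compl ips W"
    using closed_sequentially[OF closed_orth_compl] wv(3) by blast
  ultimately show "l \<in> orth_sum W" unfolding orth_sum_def mem_Collect_eq
    by (intro exI[of _ u] exI[of _ "l - u"]) simp
qed

lemma orth_complemented_iff:
  assumes "submodule (act_sum actE actF) W"
  shows "orth_complemented (act_sum actE actF) ips W \<longleftrightarrow> orth_sum W = UNIV"
proof -
  have "0 \<in> W" using assms by (simp add: submodule_def)
  moreover have "0 \<in> orth_compl ips W"
    by (simp add: orth_compl_def bounded_bilinear.zero_left[OF bounded_bilinear_ips])
  ultimately have "W \<inter> orth_compl ips W = {0}" using orth_compl_inter by blast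
  moreover have "m \<in> orth_sum W \<longleftrightarrow> (\<exists>w\<in>W. \<exists>v\<in>orth_compl ips W. m = w + v)" for m
    unfolding orth_sum_def by blast
  ultimately show ?thesis
    using assms unfolding orth_complemented_def by (simp add: set_eq_iff[of "orth_sum W"])
qed

lemma subset_orth_compl_orth_compl: "W \<subseteq> orth_compl ips (orth_compl ips W)"
  using ips_orth_commute by (auto simp: orth_compl_def)

lemma orth_compl_orth_compl_eq:
  assumes "orth_sum W = UNIV"
  shows "orth_compl ips (orth_compl ips W) = W"
proof
  show "orth_compl ips (orth_compl ips W) \<subseteq> W"
  proof
    fix z
    assume z: "z \<in> orth_compl ips (orth_compl ips W)"
    have "z \<in> orth_sum W" using assms by simp
    then obtain w v where wv: "z = w + v" "w \<in> W" "v \<in> orth_compl ips W"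
      by (auto simp: orth_sum_def)
    have "z - w \<in> orth_compl ips (orth_compl ips W)"
      using orth_compl_diff[OF z] subset_orth_compl_orth_compl wv(2) by blast
    then have "v = 0" using orth_compl_inter[OF wv(3)] wv(1) by simp
    then show "z \<in> W" using wv by simp
  qed
qed (rule subset_orth_compl_orth_compl)

lemma range_orth_proj_orth_compl:
  assumes "orth_sum W = UNIV"
  shows "range (orth_proj ips (orth_compl ips W)) = orth_compl ips W"
proof -
  let ?V = "orth_compl ips W"
  have proj: "orth_proj ips ?V (w + v) = v" if "w \<in> W" "v \<in> ?V" for w v
    unfolding orth_proj_def
  proof (rule the_equality)
    show "v \<in> ?V \<and> w + v - v \<in> orth_compl ips ?V"
      using that subset_orth_compl_orth_compl by auto
    fix v'
    assume v': "v' \<in> ?V \<and> w + v - v' \<in> orth_compl ips ?V"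
    then have "(w + v - v') - w \<in> orth_compl ips ?V"
      using orth_compl_diff that subset_orth_compl_orth_compl by blast
    moreover have "v - v' \<in> ?V" using orth_compl_diff that v' by blast
    ultimately show "v' = v" using orth_compl_inter[of "v - v'" ?V] by simp
  qed
  have decomp: "\<exists>w\<in>W. \<exists>v\<in>?V. m = w + v" for m
    using assms unfolding orth_sum_def by blast
  show ?thesis
  proof
    show "range (orth_proj ips ?V) \<subseteq> ?V"
      using decomp proj by (metis (no_types, lifting) image_subsetI)
    show "?V \<subseteq> range (orth_proj ips ?V)"
    proof
      fix v assume v: "v \<in> ?V"
      obtain w where "w \<in> W" using decomp by blast
      then show "v \<in> range (orth_proj ips ?V)" using proj[OF _ v] by (metis rangeI)
    qed
  qed
qed

end

section \<open>The graph of a densely defined operator\<close>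

locale hilbert_module_operator = hilbert_module_pair actE ipE actF ipF
  for actE :: "'a::cstar_algebra \<Rightarrow> 'e::{complex_vector, banach} \<Rightarrow> 'e"
    and ipE :: "'e \<Rightarrow> 'e \<Rightarrow> 'a"
    and actF :: "'a \<Rightarrow> 'f::{complex_vector, banach} \<Rightarrow> 'f"
    and ipF :: "'f \<Rightarrow> 'f \<Rightarrow> 'a" +
  fixes D :: "'e set" and t :: "'e \<Rightarrow> 'f"
  assumes densely_defined: "densely_defined_operator actE actF D t"
begin

abbreviation "G \<equiv> op_graph D t"
abbreviation "Gperp \<equiv> orth_compl ips G"

lemma zero_in_dom: "0 \<in> D" and dense_dom: "closure D = UNIV"
  using densely_defined by (auto simp: densely_defined_operator_def submodule_def)

lemma op_zero: "t 0 = 0"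
  using densely_defined zero_in_dom unfolding densely_defined_operator_def
  by (metis add_cancel_right_left)

lemma submodule_graph: "submodule (act_sum actE actF) G"
  unfolding submodule_def op_graph_def act_sum_def scaleC_prod_def
  using densely_defined op_zero
  by (auto simp: densely_defined_operator_def submodule_def zero_prod_def image_iff)

lemma graph_diff:
  assumes "z \<in> G" "w \<in> G"
  shows "z - w \<in> G"
proof -
  have "(- 1) *\<^sub>C w \<in> G" using assms submodule_graph by (simp add: submodule_def)
  then have "- w \<in> G"
    by (simp add: scaleC_prod_def scaleC_minus_one uminus_prod_def)
  then have "z + - w \<in> G" using assms(1) submodule_graph by (metis submodule_def)
  then show ?thesis by simp
qed

text \<open>The orthogonal complement of the graph consists of the pairs \<open>(- t\<^sup>* y, y)\<close>.\<close>

lemma mem_graph_perp_iff: "(z, y) \<in> Gperp \<longleftrightarrow> (\<forall>x\<in>D. ipF (t x) y = ipE x (- z))"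
proof -
  have "ips (z, y) (x, t x) = 0 \<longleftrightarrow> ipF (t x) y = ipE x (- z)" for x
    using ips_orth_commute[of "(z, y)" "(x, t x)"]
    by (simp add: ip_sum_def E.ip_minus_right eq_neg_iff_add_eq_0 add.commute)
  then show ?thesis by (simp add: orth_compl_def op_graph_def)
qed

lemma adj_dom_eq: "adj_dom ipE ipF D t = snd ` Gperp"
proof -
  have "y \<in> adj_dom ipE ipF D t \<longleftrightarrow> (\<exists>z. (z, y) \<in> Gperp)" for y
    unfolding adj_dom_def mem_graph_perp_iff mem_Collect_eq by (metis minus_minus)
  then show ?thesis by force
qed

lemma adj_op_eq:
  assumes "(z, y) \<in> Gperp"
  shows "adj_op ipE ipF D t y = - z"
  unfolding adj_op_def
proof (rule the_equality)
  show "\<forall>x\<in>D. ipF (t x) y = ipE x (- z)" using assms by (simp add: mem_graph_perp_iff)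
  fix z'
  assume z': "\<forall>x\<in>D. ipF (t x) y = ipE x z'"
  have "ipE x (z' + z) = 0" if "x \<in> D" for x
    using z' assms that by (simp add: mem_graph_perp_iff E.ip_minus_right E.ip_add_right)
  then have "z' + z = 0" using E.eq_zero_if_orth_dense[OF dense_dom] by blast
  then show "z' = - z" by (simp add: eq_neg_iff_add_eq_0)
qed

lemma range_one_plus_adj_eq: "range_one_plus_adj ipE ipF D t = {x. (x, 0) \<in> orth_sum G}"
proof (intro set_eqI iffI)
  fix x
  assume "x \<in> range_one_plus_adj ipE ipF D t"
  then obtain u where u: "x = u + adj_op ipE ipF D t (t u)" "u \<in> D" "t u \<in> adj_dom ipE ipF D t"
    by (auto simp: range_one_plus_adj_def)
  then obtain z where z: "(z, t u) \<in> Gperp" by (force simp: adj_dom_eq)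
  have "(u, t u) - (z, t u) = (x, 0)" using u(1) adj_op_eq[OF z] by simp
  moreover have "0 - (z, t u) \<in> Gperp"
    by (rule orth_compl_diff[OF _ z])
      (simp add: orth_compl_def bounded_bilinear.zero_left[OF bounded_bilinear_ips])
  moreover have "(u, t u) \<in> G" using u(2) by (simp add: op_graph_def)
  ultimately show "x \<in> {x. (x, 0) \<in> orth_sum G}" unfolding orth_sum_def by force
next
  fix x
  assume "x \<in> {x. (x, 0) \<in> orth_sum G}"
  then obtain u v where uv: "u \<in> D" "v \<in> Gperp" "(x, 0) = (u, t u) + v"
    by (auto simp: orth_sum_def op_graph_def)
  then have v: "v = (x - u, - t u)" by (cases v) (auto simp: eq_neg_iff_add_eq_0 add.commute)
  have "0 - v \<in> Gperp"
    by (rule orth_compl_diff[OF _ uv(2)])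
      (simp add: orth_compl_def bounded_bilinear.zero_left[OF bounded_bilinear_ips])
  then have "(u - x, t u) \<in> Gperp" by (simp add: v zero_prod_def)
  then have "t u \<in> adj_dom ipE ipF D t" "adj_op ipE ipF D t (t u) = x - u"
    using adj_op_eq by (force simp: adj_dom_eq)+
  then show "x \<in> range_one_plus_adj ipE ipF D t"
    unfolding range_one_plus_adj_def using uv(1) by force
qed

text \<open>A vector \<open>y\<close> orthogonal to \<open>Dom(t\<^sup>*)\<close> makes \<open>(0, y)\<close> orthogonal to the complement of the graph,
  hence an element of the graph.\<close>

lemma adj_dom_orth_compl:
  assumes "orth_sum G = UNIV"
  shows "orth_compl ipF (adj_dom ipE ipF D t) = {0}"
proof -
  have "y = 0" if y: "y \<in> orth_compl ipF (adj_dom ipE ipF D t)" for y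
  proof -
    have "(0, y) \<in> orth_compl ips Gperp"
      using y by (auto simp: orth_compl_def[of ips Gperp] ip_sum_def orth_compl_def[of ipF] adj_dom_eq)
    then have "(0, y) \<in> G" using orth_compl_orth_compl_eq[OF assms] by simp
    then show "y = 0" using op_zero by (auto simp: op_graph_def)
  qed
  moreover have "0 \<in> orth_compl ipF (adj_dom ipE ipF D t)" by (simp add: orth_compl_def)
  ultimately show ?thesis by blast
qed

lemma regular_if_graph_complemented:
  assumes sum: "orth_sum G = UNIV"
    and biorth: "closure (adj_dom ipE ipF D t) = orth_compl ipF (orth_compl ipF (adj_dom ipE ipF D t))"
  shows "regular_operator ipE ipF D t"
  unfolding regular_operator_def
proof (intro conjI)
  have "orth_compl ipF {0} = UNIV"
    using bounded_bilinear.zero_right[OF F.bounded_bilinear_ip] by (simp add: orth_compl_def)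
  then show "adjointable ipE ipF D t"
    using biorth adj_dom_orth_compl[OF sum] by (simp add: adjointable_def)
  show "closed_operator D t"
    using closed_orth_compl[of Gperp] orth_compl_orth_compl_eq[OF sum]
    by (simp add: closed_operator_def)
  show "closure (range_one_plus_adj ipE ipF D t) = UNIV"
    by (simp add: range_one_plus_adj_eq sum)
qed

lemma orth_sum_diff:
  assumes "z \<in> orth_sum G" "w \<in> orth_sum G"
  shows "z - w \<in> orth_sum G"
proof -
  obtain g v g' v' where "z = g + v" "w = g' + v'" "g \<in> G" "v \<in> Gperp" "g' \<in> G" "v' \<in> Gperp"
    using assms by (auto simp: orth_sum_def)
  then have "z - w = (g - g') + (v - v')" "g - g' \<in> G" "v - v' \<in> Gperp"
    using graph_diff orth_compl_diff by simp_all
  then show ?thesis unfolding orth_sum_def mem_Collect_eq by blast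
qed

text \<open>Closedness of \<open>G + G\<^sup>\<bottom>\<close> upgrades density twice: of the range of \<open>1 + t\<^sup>* t\<close> for the vectors
  \<open>(x, 0)\<close>, and of \<open>Dom(t\<^sup>*)\<close> for the vectors \<open>(0, y)\<close>.\<close>

lemma orth_sum_graph_if_regular:
  assumes "regular_operator ipE ipF D t"
  shows "orth_sum G = UNIV"
proof -
  have adj: "closure (adj_dom ipE ipF D t) = UNIV" and closed_G: "closed G"
    and dense: "closure (range_one_plus_adj ipE ipF D t) = UNIV"
    using assms by (simp_all add: regular_operator_def adjointable_def closed_operator_def)
  have closed: "closed (orth_sum G)"
    using closed_orth_sum[OF closed_G graph_diff] by blast
  have "range_one_plus_adj ipE ipF D t = (\<lambda>x. (x, 0)) -` orth_sum G"
    by (auto simp: range_one_plus_adj_eq)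
  moreover have "closed ((\<lambda>x. (x, 0)) -` orth_sum G)"
    by (rule continuous_closed_vimage[OF closed]) (intro continuous_intros)
  ultimately have "(\<lambda>x. (x, 0)) -` orth_sum G = UNIV"
    using dense closure_closed by metis
  then have E: "(x, 0) \<in> orth_sum G" for x by auto
  have "(0, y) \<in> orth_sum G" if y: "y \<in> adj_dom ipE ipF D t" for y
  proof -
    obtain z where z: "(z, y) \<in> Gperp" using y by (force simp: adj_dom_eq)
    have "0 + (z, y) \<in> orth_sum G"
      unfolding orth_sum_def mem_Collect_eq using z submodule_graph[unfolded submodule_def] by blast
    from orth_sum_diff[OF this E[of z]] show ?thesis by simp
  qed
  moreover have "closed ((\<lambda>y. (0, y)) -` orth_sum G)"
    by (rule continuous_closed_vimage[OF closed]) (intro continuous_intros)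
  ultimately have F: "(0, y) \<in> orth_sum G" for y
    using adj closure_minimal[of "adj_dom ipE ipF D t" "(\<lambda>y. (0, y)) -` orth_sum G"] by auto
  have "(x, y) \<in> orth_sum G" for x y
    using orth_sum_diff[OF E[of x] F[of "- y"]] by simp
  then show ?thesis by auto
qed

end

theorem corollary3p2:
  fixes actE :: "'a::cstar_algebra \<Rightarrow> 'e::{complex_vector, banach} \<Rightarrow> 'e"
    and ipE :: "'e \<Rightarrow> 'e \<Rightarrow> 'a"
    and actF :: "'a \<Rightarrow> 'f::{complex_vector, banach} \<Rightarrow> 'f"
    and ipF :: "'f \<Rightarrow> 'f \<Rightarrow> 'a"
    and D :: "'e set"
    and t :: "'e \<Rightarrow> 'f"
  assumes "hilbert_module actE ipE"
    and "hilbert_module actF ipF"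
    and "densely_defined_operator actE actF D t"
  shows "(orth_complemented (act_sum actE actF) (ip_sum ipE ipF) (op_graph D t) \<and>
      closure (range (snd \<circ> orth_proj (ip_sum ipE ipF) (orth_compl (ip_sum ipE ipF) (op_graph D t)))) =
      orth_compl ipF (orth_compl ipF
        (range (snd \<circ> orth_proj (ip_sum ipE ipF) (orth_compl (ip_sum ipE ipF) (op_graph D t))))))
    \<longleftrightarrow> regular_operator ipE ipF D t"
proof -
  interpret E: hilbert_module actE ipE by fact
  interpret F: hilbert_module actF ipF by fact
  interpret hilbert_module_operator actE ipE actF ipF D t
    by unfold_locales fact
  let ?R = "range (snd \<circ> orth_proj ips Gperp)" and ?A = "adj_dom ipE ipF D t"
  have complemented: "orth_complemented (act_sum actE actF) ips G \<longleftrightarrow> orth_sum G = UNIV"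
    by (rule orth_complemented_iff[OF submodule_graph])
  have range: "?R = ?A" if "orth_sum G = UNIV"
    unfolding adj_dom_eq image_comp[symmetric] range_orth_proj_orth_compl[OF that] ..
  show ?thesis
  proof
    assume "orth_complemented (act_sum actE actF) ips G \<and>
      closure ?R = orth_compl ipF (orth_compl ipF ?R)"
    then show "regular_operator ipE ipF D t"
      using regular_if_graph_complemented range complemented by metis
  next
    assume regular: "regular_operator ipE ipF D t"
    then have sum: "orth_sum G = UNIV" by (rule orth_sum_graph_if_regular)
    have "closure ?A = UNIV"
      using regular by (simp add: regular_operator_def adjointable_def)
    moreover have "orth_compl ipF {0} = UNIV"
      using bounded_bilinear.zero_right[OF F.bounded_bilinear_ip] by (simp add: orth_compl_def)
    ultimately show "orth_complemented (act_sum actE actF) ips G \<and>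
      closure ?R = orth_compl ipF (orth_compl ipF ?R)"
      unfolding complemented range[OF sum] adj_dom_orth_compl[OF sum] by (simp add: sum)
  qed
qed

end
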